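(* Let $b\ge 1$ be an integer, $q\in[0,1)$, $h$ a permutation of $\{1,\dots,b\}$ with $h(h(i))=i$ for all $i$, and $\{p_k\}_{k\ge 0}$ a probability distribution with $0<E(Z):=\sum_{k\ge0}kp_k<\infty$. Let $H_1,\dots,H_b$ be mutually disjoint sets with $\bigcup_{i=1}^bH_i=\{0,1,2,\dots\}$ and $\sum_{k\in H_i}kp_k=E(Z)/b$ for all $i$. For $n$ ranging over an infinite set of positive integers, let $G_n$ be the random multigraph on $n$ vertices produced by the generalized configuration model with parameters $b,q,h$ from a degree sequence $k_1,\dots,k_n$ (depending on $n$) with $2m=\sum_i k_i$, such that for each $i$ block $i$ consists exactly of the $2m/b$ stubs that belong to vertices with degree in $H_i$. Assume that, as $n\to\infty$, $\frac1n|\{v: k_v=k\}|\to p_k$ for every $k$ and $2m/n\to E(Z)$. Choose a uniformly random edge of $G_n$ with a uniformly random orientation (equivalently, choose a uniformly random stub $t$ and let $s$ be the stub to which it is connected), let $Y$ be the degree of the vertex to which $t$ belongs and $X$ the degree of the vertex to which $s$ belongs. Then, in the limit $n\to\infty$, the marginal probability mass functions are $$\Pr(X=x)=\frac{xp_x}{E(Z)},\qquad \Pr(Y=y)=\frac{yp_y}{E(Z)},$$ and the joint probability mass function is $$\Pr(X=x,Y=y)=C_{ij}\,\frac{xy\,p_xp_y}{(E(Z))^2}\qquad\text{for }x\in H_i,\ y\in H_j,$$ where $C_{ij}=bq+1-q$ if $h(i)=j$ and $C_{ij}=1-q$ if $h(i)\neq j$ (that is, for all fixed $x,y$ the probabilities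 on the left converge to the quantities on the right as $n\to\infty$).
   Context: Generalized configuration model. Input: a degree sequence $k_1,\dots,k_n$ with $2m=\sum_i k_i$ even and divisible by $b$, a parameter $q\in[0,1)$, and a permutation $h$ of $\{1,\dots,b\}$ with $h(h(i))=i$. Vertex $v$ gets $k_v$ stubs (half-edges). The $2m$ stubs are sorted by the degree of the vertex to which they belong and split, in this order, into $b$ consecutive blocks of $2m/b$ stubs each. In each block, a uniformly random set of $\lceil 2mq/b\rceil$ stubs is designated type 1; the others are type 2. Then, repeatedly, an unconnected stub is selected at random: if it is a type 1 stub in block $i$, it is connected to a uniformly random other unconnected type 1 stub in block $h(i)$; if it is of type 2, it is connected to a uniformly random other unconnected type 2 stub among all blocks. This continues until all stubs are connected. The numbers are assumed to be such that this procedure can be completed (i.e. $\lceil 2mq/b\rceil$ is even whenever $h$ has a fixed point). Self-edges and multi-edges are allowed. Probabilities are over the designation of types, the matching, and the choice of the edge. *)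

theory Defs
  imports "HOL-Probability.Probability"
begin

text \<open>
  Vertices are \<open>1, \<dots>, n\<close>, with degree sequence \<open>k\<close>. The pair \<open>(v, j)\<close> with \<open>j < k v\<close> is the
  \<open>j\<close>-th stub of vertex \<open>v\<close>, so \<^const>\<open>fst\<close> gives the vertex to which a stub belongs.
\<close>

type_synonym stub = "nat \<times> nat"

definition stubs :: "nat \<Rightarrow> (nat \<Rightarrow> nat) \<Rightarrow> stub set" where
  "stubs n k = (SIGMA v:{1..n}. {..<k v})"

definition num_stubs :: "nat \<Rightarrow> (nat \<Rightarrow> nat) \<Rightarrow> nat" where
  "num_stubs n k = (\<Sum>v = 1..n. k v)"

text \<open>
  The sorting is stable: stubs of equal degree stay in lexicographic order. The tie-breaking is
  immaterial whenever each block is the set of all stubs with degree in a prescribed set.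
\<close>

definition stub_list :: "nat \<Rightarrow> (nat \<Rightarrow> nat) \<Rightarrow> stub list" where
  "stub_list n k = sort_key (\<lambda>s. k (fst s)) [(v, j). v \<leftarrow> [1..<Suc n], j \<leftarrow> [0..<k v]]"

definition block :: "nat \<Rightarrow> (nat \<Rightarrow> nat) \<Rightarrow> nat \<Rightarrow> nat \<Rightarrow> stub set" where
  "block n k b i = set (take (num_stubs n k div b) (drop ((i - 1) * (num_stubs n k div b)) (stub_list n k)))"

definition num_type1 :: "nat \<Rightarrow> (nat \<Rightarrow> nat) \<Rightarrow> nat \<Rightarrow> real \<Rightarrow> nat" where
  "num_type1 n k b q = nat \<lceil>real (num_stubs n k) * q / real b\<rceil>"

text \<open>The random set of all type 1 stubs; the choices in different blocks are independent.\<close>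

definition type1_pmf :: "nat \<Rightarrow> (nat \<Rightarrow> nat) \<Rightarrow> nat \<Rightarrow> real \<Rightarrow> stub set pmf" where
  "type1_pmf n k b q =
     map_pmf (\<lambda>D. \<Union>i\<in>{1..b}. D i)
       (Pi_pmf {1..b} {} (\<lambda>i. pmf_of_set {T. T \<subseteq> block n k b i \<and> card T = num_type1 n k b q}))"

text \<open>
  The stubs to which the selected stub \<open>s\<close> may be connected, when \<open>T\<close> is the set of type 1 stubs
  and \<open>U\<close> the set of unconnected stubs.
\<close>

definition candidates ::
  "nat \<Rightarrow> (nat \<Rightarrow> nat) \<Rightarrow> nat \<Rightarrow> (nat \<Rightarrow> nat) \<Rightarrow> stub set \<Rightarrow> stub set \<Rightarrow> stub \<Rightarrow> stub set" where
  "candidates n k b h T U s =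
     (if s \<in> T
      then {t \<in> U - {s}. t \<in> T \<and> (\<exists>i\<in>{1..b}. s \<in> block n k b i \<and> t \<in> block n k b (h i))}
      else {t \<in> U - {s}. t \<notin> T})"

text \<open>
  \<open>connect C r U\<close> performs \<open>r\<close> rounds of the procedure, starting from the set \<open>U\<close> of unconnected
  stubs. Every round uses up two stubs, so \<open>card U div 2\<close> rounds connect all of an even number of
  stubs. An edge is recorded as the pair of the selected stub and the stub it is connected to.
  As stubs are distinguishable, a set of such pairs represents multi-edges faithfully.
\<close>

primrec connect ::
  "(stub set \<Rightarrow> stub \<Rightarrow> stub set) \<Rightarrow> nat \<Rightarrow> stub set \<Rightarrow> (stub \<times> stub) set pmf" where
  "connect C 0 U = return_pmf {}"
| "connect C (Suc r) U =
     do {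
       s \<leftarrow> pmf_of_set U;
       t \<leftarrow> pmf_of_set (C U s);
       M \<leftarrow> connect C r (U - {s, t});
       return_pmf (insert (s, t) M)
     }"

text \<open>The random multigraph, given by its set of edges between stubs.\<close>

definition config_model ::
  "nat \<Rightarrow> (nat \<Rightarrow> nat) \<Rightarrow> nat \<Rightarrow> real \<Rightarrow> (nat \<Rightarrow> nat) \<Rightarrow> (stub \<times> stub) set pmf" where
  "config_model n k b q h =
     do {
       T \<leftarrow> type1_pmf n k b q;
       connect (candidates n k b h T) (num_stubs n k div 2) (stubs n k)
     }"

text \<open>
  The joint distribution of the degrees \<open>(X, Y)\<close> at the ends of a uniformly random edge with a
  uniformly random orientation. It is meaningful only if there is at least one edge.
\<close>

definition edge_degrees ::
  "nat \<Rightarrow> (nat \<Rightarrow> nat) \<Rightarrow> nat \<Rightarrow> real \<Rightarrow> (nat \<Rightarrow> nat) \<Rightarrow> (nat \<times> nat) pmf" where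
  "edge_degrees n k b q h =
     do {
       M \<leftarrow> config_model n k b q h;
       (s', t') \<leftarrow> pmf_of_set M;
       (s, t) \<leftarrow> pmf_of_set {(s', t'), (t', s')};
       return_pmf (k (fst s), k (fst t))
     }"

end

theory Submission imports Defs begin

text \<open>
  Once the set \<open>T\<close> of type 1 stubs is fixed, give a stub class \<open>i\<close> if it is a type 1 stub of block
  \<open>i\<close> and class \<open>0\<close> if it is of type 2. With \<open>h 0 = 0\<close>, the rule of the procedure is that a stub of
  class \<open>a\<close> is connected to a stub of class \<open>h a\<close>. The law of the resulting matching is invariant
  under exchanging two stubs of the same class, so the partner of a given stub is uniform on the
  stubs of the right class. Averaging over \<open>T\<close> gives, for stubs in blocks \<open>i\<close> and \<open>j\<close>, an exact
  probability that depends only on \<open>i\<close> and \<open>j\<close>. Multiplied by \<open>(2m)\<^sup>2\<close>, it tends to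
  \<open>bq\<cdot>[h i = j] + (1 - q)\<close>, the two terms coming from type 1 and type 2 edges.
\<close>

section \<open>Matchings between classes of stubs\<close>

definition compatible :: "(stub \<Rightarrow> 'c) \<Rightarrow> ('c \<Rightarrow> 'c) \<Rightarrow> stub set \<Rightarrow> stub \<Rightarrow> stub set" where
  "compatible c g U s = {t \<in> U - {s}. c t = g (c s)}"

text \<open>The invariant that keeps the procedure from getting stuck: classes matched with each
  other run out together, and a class matched with itself never holds just one stub at the start of
  a round.\<close>

definition balanced :: "(stub \<Rightarrow> 'c) \<Rightarrow> ('c \<Rightarrow> 'c) \<Rightarrow> stub set \<Rightarrow> bool" where
  "balanced c g U \<longleftrightarrow> (\<forall>a. card {u \<in> U. c u = g a} = card {u \<in> U. c u = a} \<and>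
     (g a = a \<longrightarrow> even (card {u \<in> U. c u = a})))"

lemma card_remove_pair:
  assumes "finite U" "s \<in> U" "t \<in> U" "s \<noteq> t"
  shows "card {u \<in> U. P u} = card {u \<in> U - {s, t}. P u} + of_bool (P s) + of_bool (P t)"
proof -
  have "{u \<in> U. P u} = {u \<in> U - {s, t}. P u} \<union> {u \<in> {s, t}. P u}"
    using assms by auto
  moreover have "card ({u \<in> U - {s, t}. P u} \<union> {u \<in> {s, t}. P u})
      = card {u \<in> U - {s, t}. P u} + card {u \<in> {s, t}. P u}"
    using assms by (intro card_Un_disjoint) auto
  moreover have "{u \<in> {s, t}. P u} = (if P s then {s} else {}) \<union> (if P t then {t} else {})"
    by auto
  ultimately show ?thesis
    using assms by auto
qed

text \<open>A round uses up one stub of class \<open>c s\<close> and one of class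
  \<open>g (c s)\<close>. If these classes differ, both shrink by one; if they coincide, the class
  shrinks by two and keeps its parity.\<close>

lemma balanced_remove_pair:
  assumes g: "\<And>a. g (g a) = a" and "finite U" "balanced c g U"
    and "s \<in> U" "t \<in> compatible c g U s"
  shows "balanced c g (U - {s, t})"
  unfolding balanced_def
proof (intro allI conjI impI)
  have t: "t \<in> U" "s \<noteq> t" "c t = g (c s)"
    using assms by (auto simp: compatible_def)
  note rem = card_remove_pair[OF \<open>finite U\<close> \<open>s \<in> U\<close> t(1,2)]
  fix a
  have eq: "c s = g a \<longleftrightarrow> c t = a" "c t = g a \<longleftrightarrow> c s = a"
    using t(3) g by metis+
  have "card {u \<in> U. c u = g a} = card {u \<in> U. c u = a}"
    using assms by (auto simp: balanced_def)
  thus "card {u \<in> U - {s, t}. c u = g a} = card {u \<in> U - {s, t}. c u = a}"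
    unfolding rem eq by simp
  assume a: "g a = a"
  have "even (card {u \<in> U. c u = a})"
    using assms a by (auto simp: balanced_def)
  moreover have "c s = a \<longleftrightarrow> c t = a"
    using eq a by simp
  ultimately show "even (card {u \<in> U - {s, t}. c u = a})"
    unfolding rem by (auto split: if_splits)
qed

lemma card_compatible:
  assumes "finite U" "balanced c g U" "s \<in> U"
  shows "card (compatible c g U s) = card {u \<in> U. c u = c s} - of_bool (c s = g (c s))"
proof -
  have "compatible c g U s = {u \<in> U. c u = g (c s)} - {s}"
    by (auto simp: compatible_def)
  moreover have "card {u \<in> U. c u = g (c s)} = card {u \<in> U. c u = c s}"
    using assms by (auto simp: balanced_def)
  ultimately show ?thesis
    using assms by (auto simp: card_Diff_singleton_if)
qed

text \<open>The class \<open>g (c s)\<close> is as large as the class of \<open>s\<close>, which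
  contains \<open>s\<close>. So a partner could be missing only from a self-matched class of size 1,
  which parity forbids. Nonemptiness is what gives \<open>pmf_of_set\<close> its meaning at each
  draw.\<close>

lemma compatible_nonempty:
  assumes "finite U" "balanced c g U" "s \<in> U"
  shows "compatible c g U s \<noteq> {}"
proof
  assume *: "compatible c g U s = {}"
  have "card {u \<in> U. c u = c s} > 0"
    using assms(1,3) card_gt_0_iff[of "{u \<in> U. c u = c s}"] by fastforce
  moreover have "card {u \<in> U. c u = c s} - of_bool (c s = g (c s)) = 0"
    using card_compatible[OF assms] * by simp
  ultimately have "card {u \<in> U. c u = c s} = 1" "c s = g (c s)"
    by (cases "c s = g (c s)"; simp)+
  thus False
    using assms(2) by (metis balanced_def odd_one)
qed

lemma finite_compatible: "finite U \<Longrightarrow> finite (compatible c g U s)"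
  by (simp add: compatible_def)

section \<open>The connection procedure: change of rule, relabelling of stubs, possible
  outcomes\<close>

lemma connect_cong:
  assumes g: "\<And>a. g (g a) = a"
    and C: "\<And>U s. U \<subseteq> S \<Longrightarrow> s \<in> U \<Longrightarrow> C U s = compatible c g U s"
    and "finite U" "balanced c g U" "card U = 2 * r" "U \<subseteq> S"
  shows "connect C r U = connect (compatible c g) r U"
  using assms(3-)
proof (induction r arbitrary: U)
  case (Suc r)
  have U: "U \<noteq> {}"
    using Suc.prems by auto
  \<comment> \<open>Only pairs that can be drawn matter. Their removal leaves a balanced set again,
    so the two rules need to agree only on the states that are actually reached.\<close>
  have "connect C r (U - {s, t}) = connect (compatible c g) r (U - {s, t})"
    if "s \<in> U" "t \<in> compatible c g U s" for s t
  proof (rule Suc.IH)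
    show "balanced c g (U - {s, t})"
      using Suc.prems that g by (intro balanced_remove_pair) auto
    show "card (U - {s, t}) = 2 * r"
      using Suc.prems that by (auto simp: card_Diff_subset compatible_def)
  qed (use Suc.prems in auto)
  note * = this
  show ?case
    unfolding connect.simps
  proof (rule bind_pmf_cong[OF refl])
    fix s assume "s \<in> set_pmf (pmf_of_set U)"
    hence s: "s \<in> U"
      using U Suc.prems by simp
    show "pmf_of_set (C U s) \<bind>
        (\<lambda>t. connect C r (U - {s, t}) \<bind> (\<lambda>M. return_pmf (insert (s, t) M))) =
      pmf_of_set (compatible c g U s) \<bind>
        (\<lambda>t. connect (compatible c g) r (U - {s, t}) \<bind> (\<lambda>M. return_pmf (insert (s, t) M)))"
      unfolding C[OF Suc.prems(4) s]
    proof (rule bind_pmf_cong[OF refl])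
      fix t assume "t \<in> set_pmf (pmf_of_set (compatible c g U s))"
      hence "t \<in> compatible c g U s"
        using compatible_nonempty[OF Suc.prems(1,2) s] Suc.prems(1) by (simp add: finite_compatible)
      thus "connect C r (U - {s, t}) \<bind> (\<lambda>M. return_pmf (insert (s, t) M)) =
        connect (compatible c g) r (U - {s, t}) \<bind> (\<lambda>M. return_pmf (insert (s, t) M))"
        using *[OF s] by simp
    qed
  qed
qed simp

text \<open>An injective relabelling that preserves classes maps each set of possible choices onto
  the corresponding set for the relabelled state, so by induction it commutes with every
  round.\<close>

lemma connect_image:
  assumes g: "\<And>a. g (g a) = a" and "inj \<pi>"
    and "\<And>u. u \<in> U \<Longrightarrow> c (\<pi> u) = c u"
    and "finite U" "balanced c g U" "card U = 2 * r"
  shows "connect (compatible c g) r (\<pi> ` U) =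
    map_pmf (image (map_prod \<pi> \<pi>)) (connect (compatible c g) r U)"
  using assms(3-)
proof (induction r arbitrary: U)
  case (Suc r)
  note inj = \<open>inj \<pi>\<close>
  have inj_on: "inj_on \<pi> A" for A
    using inj by (rule inj_on_subset) simp
  have U: "U \<noteq> {}"
    using Suc.prems by auto
  have comp: "compatible c g (\<pi> ` U) (\<pi> s) = \<pi> ` compatible c g U s" if "s \<in> U" for s
    using that Suc.prems(1) inj by (auto simp: compatible_def inj_eq)
  have pmf_comp: "pmf_of_set (compatible c g (\<pi> ` U) (\<pi> s)) =
      map_pmf \<pi> (pmf_of_set (compatible c g U s))" if "s \<in> U" for s
    using that Suc.prems
    by (simp add: comp map_pmf_of_set_inj[OF inj_on] compatible_nonempty finite_compatible)
  have IH: "connect (compatible c g) r (\<pi> ` U - {\<pi> s, \<pi> t}) =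
      map_pmf (image (map_prod \<pi> \<pi>)) (connect (compatible c g) r (U - {s, t}))"
    if "s \<in> U" "t \<in> compatible c g U s" for s t
  proof -
    have "\<pi> ` U - {\<pi> s, \<pi> t} = \<pi> ` (U - {s, t})"
      using inj by (auto simp: inj_eq)
    moreover have "connect (compatible c g) r (\<pi> ` (U - {s, t})) =
        map_pmf (image (map_prod \<pi> \<pi>)) (connect (compatible c g) r (U - {s, t}))"
    proof (rule Suc.IH)
      show "balanced c g (U - {s, t})"
        using Suc.prems that g by (intro balanced_remove_pair) auto
      show "card (U - {s, t}) = 2 * r"
        using Suc.prems that by (auto simp: card_Diff_subset compatible_def)
    qed (use Suc.prems in auto)
    ultimately show ?thesis
      by simp
  qed
  have "connect (compatible c g) (Suc r) (\<pi> ` U) =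
    pmf_of_set U \<bind> (\<lambda>s. pmf_of_set (compatible c g (\<pi> ` U) (\<pi> s)) \<bind> (\<lambda>t.
      connect (compatible c g) r (\<pi> ` U - {\<pi> s, t}) \<bind> (\<lambda>M. return_pmf (insert (\<pi> s, t) M))))"
    using U Suc.prems by (simp add: map_pmf_of_set_inj[OF inj_on, symmetric] bind_map_pmf)
  also have "\<dots> = pmf_of_set U \<bind> (\<lambda>s. pmf_of_set (compatible c g U s) \<bind> (\<lambda>t.
      connect (compatible c g) r (\<pi> ` U - {\<pi> s, \<pi> t}) \<bind> (\<lambda>M. return_pmf (insert (\<pi> s, \<pi> t) M))))"
    using U Suc.prems(2) by (intro bind_pmf_cong[OF refl, where p = "pmf_of_set U"])
      (simp add: pmf_comp bind_map_pmf)
  also have "\<dots> = map_pmf (image (map_prod \<pi> \<pi>)) (connect (compatible c g) (Suc r) U)"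
    unfolding connect.simps map_bind_pmf
  proof (rule bind_pmf_cong[OF refl], rule bind_pmf_cong[OF refl])
    fix s t
    assume s: "s \<in> set_pmf (pmf_of_set U)" and t: "t \<in> set_pmf (pmf_of_set (compatible c g U s))"
    from s have s: "s \<in> U"
      using U Suc.prems by simp
    with t have t: "t \<in> compatible c g U s"
      using Suc.prems by (simp add: compatible_nonempty finite_compatible)
    show "connect (compatible c g) r (\<pi> ` U - {\<pi> s, \<pi> t}) \<bind>
        (\<lambda>M. return_pmf (insert (\<pi> s, \<pi> t) M)) =
      connect (compatible c g) r (U - {s, t}) \<bind>
        (\<lambda>M. map_pmf (image (map_prod \<pi> \<pi>)) (return_pmf (insert (s, t) M)))"
      by (simp add: IH[OF s t] bind_map_pmf)
  qed
  finally show ?case .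
qed simp

text \<open>Each round removes its two stubs, so no stub is used twice, and after \<open>r\<close>
  rounds none of the \<open>2 * r\<close> stubs is left. Adding the converse relation lists every
  edge in both orientations, which turns this into a bijection: each stub is the first end of
  exactly one oriented edge.\<close>

lemma connect_support:
  assumes g: "\<And>a. g (g a) = a"
    and "M \<in> set_pmf (connect (compatible c g) r U)"
    and "finite U" "balanced c g U" "card U = 2 * r"
  shows "finite M \<and> M \<inter> M\<inverse> = {} \<and> (\<forall>(s, t) \<in> M \<union> M\<inverse>. s \<in> U \<and> t \<in> compatible c g U s) \<and>
    bij_betw fst (M \<union> M\<inverse>) U"
  using assms(2-)
proof (induction r arbitrary: U M)
  case (Suc r)
  have U: "U \<noteq> {}"
    using Suc.prems by auto
  obtain s where s: "s \<in> U" and "M \<in> set_pmf (pmf_of_set (compatible c g U s) \<bind>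
      (\<lambda>t. connect (compatible c g) r (U - {s, t}) \<bind> (\<lambda>M. return_pmf (insert (s, t) M))))"
    using Suc.prems(1) unfolding connect.simps set_bind_pmf set_pmf_of_set[OF U Suc.prems(2)] by blast
  then obtain t M' where st: "s \<in> U" "t \<in> compatible c g U s" and M: "M = insert (s, t) M'"
    and M': "M' \<in> set_pmf (connect (compatible c g) r (U - {s, t}))"
    using compatible_nonempty[OF Suc.prems(2,3) s] Suc.prems(2)
    by (auto simp: finite_compatible)
  have t: "t \<in> U" "s \<noteq> t" "c t = g (c s)"
    using st by (auto simp: compatible_def)
  have "finite M' \<and> M' \<inter> M'\<inverse> = {} \<and>
      (\<forall>(s', t') \<in> M' \<union> M'\<inverse>. s' \<in> U - {s, t} \<and> t' \<in> compatible c g (U - {s, t}) s') \<and>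
      bij_betw fst (M' \<union> M'\<inverse>) (U - {s, t})"
  proof (rule Suc.IH[OF M'])
    show "balanced c g (U - {s, t})"
      using Suc.prems st g by (intro balanced_remove_pair) auto
    show "card (U - {s, t}) = 2 * r"
      using Suc.prems st t by (auto simp: card_Diff_subset)
  qed (use Suc.prems in auto)
  hence IH: "finite M'" "M' \<inter> M'\<inverse> = {}"
      "\<And>s' t'. (s', t') \<in> M' \<union> M'\<inverse> \<Longrightarrow>
        s' \<in> U - {s, t} \<and> t' \<in> U - {s, t} \<and> s' \<noteq> t' \<and> c t' = g (c s')"
      "bij_betw fst (M' \<union> M'\<inverse>) (U - {s, t})"
    by (auto simp: compatible_def)
  have "bij_betw fst ((M' \<union> M'\<inverse>) \<union> {(s, t), (t, s)}) ((U - {s, t}) \<union> {s, t})"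
    using t by (intro bij_betw_combine IH) (auto simp: bij_betw_def)
  moreover have "(M' \<union> M'\<inverse>) \<union> {(s, t), (t, s)} = M \<union> M\<inverse>" "(U - {s, t}) \<union> {s, t} = U"
    using M t st by auto
  ultimately have "bij_betw fst (M \<union> M\<inverse>) U"
    by simp
  \<comment> \<open>\<open>M'\<close> is built after \<open>s\<close> and \<open>t\<close> are gone,
    so it cannot contain the reversed new edge.\<close>
  moreover have "(t, s) \<notin> M'"
    using IH(3)[of t s] by blast
  hence "M \<inter> M\<inverse> = {}"
    unfolding M using IH(2) t(2) by blast
  moreover have "s' \<in> U \<and> t' \<in> compatible c g U s'" if "(s', t') \<in> M \<union> M\<inverse>" for s' t'
    using that IH(3)[of s' t'] M t st g by (auto simp: compatible_def)
  moreover have "finite M"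
    using IH(1) M by simp
  ultimately show ?case
    by blast
qed (auto simp: bij_betw_def)

section \<open>A uniformly random oriented edge of the matching\<close>

definition matched_pair ::
  "(stub \<Rightarrow> 'c) \<Rightarrow> ('c \<Rightarrow> 'c) \<Rightarrow> nat \<Rightarrow> stub set \<Rightarrow> (stub \<times> stub) pmf" where
  "matched_pair c g r U =
     connect (compatible c g) r U \<bind> (\<lambda>M. pmf_of_set (M \<union> M\<inverse>))"

text \<open>The sets \<open>{e, prod.swap e}\<close> are disjoint and equally large, so choosing
  first an edge and then its direction is uniform on their union.
  \<open>M \<inter> M\<inverse> = {}\<close> excludes both pairs \<open>(s, s)\<close> and edges
  recorded in both directions.\<close>

lemma random_orientation:
  assumes "finite M" "M \<noteq> {}" "M \<inter> M\<inverse> = {}"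
  shows "pmf_of_set M \<bind> (\<lambda>(s, t). pmf_of_set {(s, t), (t, s)}) = pmf_of_set (M \<union> M\<inverse>)"
proof -
  have "pmf_of_set (\<Union>e\<in>M. {e, prod.swap e}) =
      pmf_of_set M \<bind> (\<lambda>e. pmf_of_set {e, prod.swap e})"
  proof (rule pmf_of_set_UN)
    fix e assume "e \<in> M"
    hence "e \<noteq> prod.swap e"
      using assms(3) by (cases e) auto
    thus "card {e, prod.swap e} = 2"
      by simp
  next
    show "disjoint_family_on (\<lambda>e. {e, prod.swap e}) M"
      using assms(3) by (auto simp: disjoint_family_on_def)
  qed (use assms in auto)
  moreover have "(\<Union>e\<in>M. {e, prod.swap e}) = M \<union> M\<inverse>"
    by force
  moreover have "(\<lambda>e. pmf_of_set {e, prod.swap e}) = (\<lambda>(s, t). pmf_of_set {(s, t), (t, s)})"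
    by auto
  ultimately show ?thesis
    by metis
qed

context
  fixes c :: "stub \<Rightarrow> 'c" and g :: "'c \<Rightarrow> 'c" and r :: nat and U :: "stub set"
  assumes g: "\<And>a. g (g a) = a"
    and U: "finite U" "U \<noteq> {}" "balanced c g U" "card U = 2 * r"
begin

lemma connect_support_props:
  assumes "M \<in> set_pmf (connect (compatible c g) r U)"
  shows "finite M" "M \<noteq> {}" "M \<inter> M\<inverse> = {}" "bij_betw fst (M \<union> M\<inverse>) U"
    "\<And>s t. (s, t) \<in> M \<union> M\<inverse> \<Longrightarrow> s \<in> U \<and> t \<in> compatible c g U s"
proof -
  note * = connect_support[OF g assms U(1,3,4)]
  thus "finite M" "M \<inter> M\<inverse> = {}" "bij_betw fst (M \<union> M\<inverse>) U"
    "\<And>s t. (s, t) \<in> M \<union> M\<inverse> \<Longrightarrow> s \<in> U \<and> t \<in> compatible c g U s"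
    by blast+
  from this(3) show "M \<noteq> {}"
    using U(2) by (auto simp: bij_betw_def)
qed

lemma matched_pair_support:
  assumes "(s, t) \<in> set_pmf (matched_pair c g r U)"
  shows "s \<in> U" "t \<in> compatible c g U s"
proof -
  obtain M where M: "M \<in> set_pmf (connect (compatible c g) r U)"
    and "(s, t) \<in> set_pmf (pmf_of_set (M \<union> M\<inverse>))"
    using assms unfolding matched_pair_def set_bind_pmf by blast
  hence "(s, t) \<in> M \<union> M\<inverse>"
    using connect_support_props(1,2)[OF M] by simp
  thus "s \<in> U" "t \<in> compatible c g U s"
    using connect_support_props(5)[OF M] by blast+
qed

text \<open>Whatever the matching, every stub is the first end of exactly one oriented edge. The
  first end is thus uniform conditionally on each \<open>M\<close>, and averaging over
  \<open>M\<close> changes nothing.\<close>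

lemma fst_matched_pair: "map_pmf fst (matched_pair c g r U) = pmf_of_set U"
proof -
  have "map_pmf fst (matched_pair c g r U) =
      connect (compatible c g) r U \<bind> (\<lambda>M. pmf_of_set U)"
    unfolding matched_pair_def map_bind_pmf
  proof (rule bind_pmf_cong[OF refl])
    fix M assume M: "M \<in> set_pmf (connect (compatible c g) r U)"
    show "map_pmf fst (pmf_of_set (M \<union> M\<inverse>)) = pmf_of_set U"
      using connect_support_props(1,2,4)[OF M] by (intro map_pmf_of_set_bij_betw) simp_all
  qed
  thus ?thesis
    by simp
qed

lemma swap_matched_pair: "map_pmf prod.swap (matched_pair c g r U) = matched_pair c g r U"
  unfolding matched_pair_def map_bind_pmf
proof (rule bind_pmf_cong[OF refl])
  fix M assume M: "M \<in> set_pmf (connect (compatible c g) r U)"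
  have "map_pmf prod.swap (pmf_of_set (M \<union> M\<inverse>)) = pmf_of_set (prod.swap ` (M \<union> M\<inverse>))"
    using connect_support_props(1,2)[OF M] by (intro map_pmf_of_set_inj) simp_all
  also have "prod.swap ` (M \<union> M\<inverse>) = M \<union> M\<inverse>"
    by force
  finally show "map_pmf prod.swap (pmf_of_set (M \<union> M\<inverse>)) = pmf_of_set (M \<union> M\<inverse>)" .
qed

lemma snd_matched_pair: "map_pmf snd (matched_pair c g r U) = pmf_of_set U"
proof -
  have "map_pmf snd (matched_pair c g r U) =
      map_pmf fst (map_pmf prod.swap (matched_pair c g r U))"
    by (simp add: pmf.map_comp comp_def)
  thus ?thesis
    by (simp add: swap_matched_pair fst_matched_pair)
qed

text \<open>By \<open>connect_image\<close>, relabelling the edges of the matching gives the law of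
  a matching of the image of \<open>U\<close>, which is \<open>U\<close> again.\<close>

lemma map_prod_matched_pair:
  assumes "inj \<pi>" "\<pi> ` U = U" "\<And>u. u \<in> U \<Longrightarrow> c (\<pi> u) = c u"
  shows "map_pmf (map_prod \<pi> \<pi>) (matched_pair c g r U) = matched_pair c g r U"
proof -
  have inj: "inj_on (map_prod \<pi> \<pi>) A" for A
    using assms(1) by (auto simp: inj_on_def)
  have "map_pmf (map_prod \<pi> \<pi>) (matched_pair c g r U) =
      connect (compatible c g) r U \<bind> (\<lambda>M. pmf_of_set (map_prod \<pi> \<pi> ` (M \<union> M\<inverse>)))"
    unfolding matched_pair_def map_bind_pmf
  proof (rule bind_pmf_cong[OF refl])
    fix M assume M: "M \<in> set_pmf (connect (compatible c g) r U)"
    show "map_pmf (map_prod \<pi> \<pi>) (pmf_of_set (M \<union> M\<inverse>)) =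
        pmf_of_set (map_prod \<pi> \<pi> ` (M \<union> M\<inverse>))"
      using connect_support_props(1,2)[OF M] by (intro map_pmf_of_set_inj inj) simp_all
  qed
  also have "\<dots> = map_pmf (image (map_prod \<pi> \<pi>)) (connect (compatible c g) r U) \<bind>
      (\<lambda>M. pmf_of_set (M \<union> M\<inverse>))"
    unfolding bind_map_pmf
  proof (intro bind_pmf_cong refl arg_cong[where f = pmf_of_set])
    fix M :: "(stub \<times> stub) set"
    show "map_prod \<pi> \<pi> ` (M \<union> M\<inverse>) = map_prod \<pi> \<pi> ` M \<union> (map_prod \<pi> \<pi> ` M)\<inverse>"
      by force
  qed
  also have "map_pmf (image (map_prod \<pi> \<pi>)) (connect (compatible c g) r U) =
      connect (compatible c g) r U"
    using connect_image[OF g assms(1,3) U(1,3,4)] assms(2) by simp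
  finally show ?thesis
    by (simp add: matched_pair_def)
qed

text \<open>
  Exchanging two possible partners of \<open>s\<close> leaves the law of the matching invariant, so all of
  them are equally likely; this avoids any analysis of the order in which stubs are selected.
\<close>

lemma pmf_matched_pair:
  "pmf (matched_pair c g r U) (s, t) =
     (if s \<in> U \<and> t \<in> compatible c g U s
      then 1 / (real (card U) * real (card (compatible c g U s))) else 0)"
proof (cases "s \<in> U \<and> t \<in> compatible c g U s")
  case False
  hence "(s, t) \<notin> set_pmf (matched_pair c g r U)"
    using matched_pair_support by blast
  thus ?thesis
    unfolding if_not_P[OF False] by (simp add: set_pmf_iff)
next
  case True
  let ?D = "matched_pair c g r U" and ?C = "compatible c g U s"
  have eq: "pmf ?D (s, t') = pmf ?D (s, t)" if t': "t' \<in> ?C" for t'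
  proof -
    let ?\<pi> = "Transposition.transpose t t'"
    have tt': "t \<in> U" "t' \<in> U" "t \<noteq> s" "t' \<noteq> s" "c t = c t'"
      using True t' by (simp_all add: compatible_def)
    have "map_pmf (map_prod ?\<pi> ?\<pi>) ?D = ?D"
    proof (rule map_prod_matched_pair)
      show "?\<pi> ` U = U"
        using tt' by (simp add: transpose_image_eq)
      show "c (?\<pi> u) = c u" for u
        using tt' by (simp add: Transposition.transpose_def)
    qed simp
    moreover have "map_prod ?\<pi> ?\<pi> (s, t) = (s, t')"
      using tt' by (simp add: Transposition.transpose_def)
    moreover have "inj (map_prod ?\<pi> ?\<pi>)"
      by (intro prod.inj_map) simp_all
    ultimately show ?thesis
      using pmf_map_inj'[of "map_prod ?\<pi> ?\<pi>" ?D "(s, t)"] by simp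
  qed
  \<comment> \<open>The first end is \<open>s\<close> with probability \<open>1 / card U\<close>;
    this mass is carried by the compatible partners alone, in equal shares.\<close>
  have "1 / real (card U) = pmf (map_pmf fst ?D) s"
    using True U by (simp add: fst_matched_pair)
  also have "\<dots> = measure ?D (fst -` {s})"
    by (simp add: pmf_map)
  also have "\<dots> = measure ?D (Pair s ` ?C)"
  proof (rule measure_prob_cong_0)
    fix e assume "e \<in> fst -` {s} - Pair s ` ?C"
    hence "e \<notin> set_pmf ?D"
      using matched_pair_support[of "fst e" "snd e"] by (cases e) auto
    thus "pmf ?D e = 0"
      by (simp add: set_pmf_iff)
  qed auto
  also have "\<dots> = (\<Sum>t'\<in>?C. pmf ?D (s, t'))"
    using U by (subst measure_measure_pmf_finite) (auto simp: finite_compatible sum.reindex inj_on_def)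
  also have "\<dots> = real (card ?C) * pmf ?D (s, t)"
    using eq by simp
  finally have *: "1 / real (card U) = real (card ?C) * pmf ?D (s, t)" .
  have "card ?C > 0"
    using True U by (auto simp: card_gt_0_iff finite_compatible)
  hence "pmf ?D (s, t) = (1 / real (card U)) / real (card ?C)"
    unfolding * by simp
  thus ?thesis
    using True by simp
qed

end

section \<open>The model with a fixed degree sequence\<close>

lemma even_card_fixpoint_free_involution:
  fixes h :: "nat \<Rightarrow> nat"
  assumes "finite A" "h ` A \<subseteq> A" "\<And>i. i \<in> A \<Longrightarrow> h (h i) = i" "\<And>i. i \<in> A \<Longrightarrow> h i \<noteq> i"
  shows "even (card A)"
proof -
  \<comment> \<open>\<open>h\<close> exchanges the points that it moves up with those that it moves
    down.\<close>
  have "bij_betw h {i \<in> A. i < h i} {i \<in> A. h i < i}"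
    using assms by (intro bij_betwI[where g = h]) auto
  hence "card {i \<in> A. i < h i} = card {i \<in> A. h i < i}"
    by (rule bij_betw_same_card)
  moreover have "A = {i \<in> A. i < h i} \<union> {i \<in> A. h i < i}"
    using assms(4) by (auto simp: neq_iff)
  moreover have "card ({i \<in> A. i < h i} \<union> {i \<in> A. h i < i}) =
      card {i \<in> A. i < h i} + card {i \<in> A. h i < i}"
    using assms(1) by (intro card_Un_disjoint) auto
  ultimately have "card A = 2 * card {i \<in> A. i < h i}"
    by simp
  thus ?thesis
    by simp
qed

lemma prob_avoid:
  assumes "finite A" "m \<le> card A" "X \<subseteq> A"
  shows "measure_pmf.prob (pmf_of_set {T. T \<subseteq> A \<and> card T = m}) {T. T \<inter> X = {}} =
    real ((card A - card X) choose m) / real (card A choose m)"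
proof -
  have "{T. T \<subseteq> A \<and> card T = m} \<noteq> {}"
    using assms(2) obtain_subset_with_card_n by blast
  moreover have "finite {T. T \<subseteq> A \<and> card T = m}"
    using assms(1) by simp
  moreover have "{T. T \<subseteq> A \<and> card T = m} \<inter> {T. T \<inter> X = {}} = {T. T \<subseteq> A - X \<and> card T = m}"
    by blast
  moreover have "card (A - X) = card A - card X"
    using assms by (simp add: card_Diff_subset finite_subset)
  ultimately show ?thesis
    using assms(1) by (simp add: measure_pmf_of_set n_subsets)
qed

text \<open>As \<open>T\<close> lies in \<open>A\<close>, it can meet \<open>X\<close> only in
  \<open>X \<inter> A\<close>. In this form one set of stubs can be tested against the draw in every
  block.\<close>

lemma prob_subset_avoid:
  assumes "finite A" "m \<le> card A"
  shows "measure_pmf.prob (pmf_of_set {T. T \<subseteq> A \<and> card T = m}) {T. T \<inter> X = {}} =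
    real ((card A - card (X \<inter> A)) choose m) / real (card A choose m)"
proof -
  have ne: "{T. T \<subseteq> A \<and> card T = m} \<noteq> {}"
    using assms(2) obtain_subset_with_card_n by blast
  have fin: "finite {T. T \<subseteq> A \<and> card T = m}"
    using assms(1) by simp
  have "measure_pmf.prob (pmf_of_set {T. T \<subseteq> A \<and> card T = m}) {T. T \<inter> X = {}} =
      measure_pmf.prob (pmf_of_set {T. T \<subseteq> A \<and> card T = m}) {T. T \<inter> (X \<inter> A) = {}}"
  proof (rule measure_prob_cong_0)
    fix T assume "T \<in> {T. T \<inter> (X \<inter> A) = {}} - {T. T \<inter> X = {}}"
    hence "T \<notin> {T. T \<subseteq> A \<and> card T = m}"
      by blast
    thus "pmf (pmf_of_set {T. T \<subseteq> A \<and> card T = m}) T = 0"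
      using ne fin by (simp add: pmf_of_set)
  qed auto
  thus ?thesis
    using prob_avoid[OF assms, of "X \<inter> A"] by simp
qed

section \<open>Stubs and blocks of a degree sequence\<close>

lemma finite_stubs: "finite (stubs n k)"
  by (simp add: stubs_def)

lemma card_stubs: "card (stubs n k) = num_stubs n k"
  by (simp add: stubs_def num_stubs_def)

lemma length_stub_list: "length (stub_list n k) = num_stubs n k"
  by (simp add: stub_list_def num_stubs_def length_concat comp_def
      interv_sum_list_conv_sum_set_nat atLeastLessThanSuc_atLeastAtMost del: upt_Suc)

lemma set_stub_list: "set (stub_list n k) = stubs n k"
  by (auto simp: stub_list_def stubs_def image_iff simp del: upt_Suc)

text \<open>The list has as many entries as different elements, so nothing repeats, whatever order
  the sort produces.\<close>

lemma distinct_stub_list: "distinct (stub_list n k)"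
  by (rule card_distinct) (simp add: set_stub_list card_stubs length_stub_list)

lemma card_block:
  assumes "i \<in> {1..b}" "b dvd num_stubs n k"
  shows "card (block n k b i) = num_stubs n k div b"
proof -
  \<comment> \<open>The slice of block \<open>i\<close> ends at position
    \<open>i * (num_stubs n k div b)\<close>, still within the list, so \<open>take\<close> is not
    cut short.\<close>
  have "(i - 1) * (num_stubs n k div b) + num_stubs n k div b = i * (num_stubs n k div b)"
    using assms(1) by (cases i) auto
  also have "\<dots> \<le> b * (num_stubs n k div b)"
    using assms(1) by simp
  also have "\<dots> = num_stubs n k"
    using assms(2) by simp
  finally show ?thesis
    unfolding block_def
    by (subst distinct_card) (simp_all add: distinct_stub_list length_stub_list)
qed

definition num_degree :: "nat \<Rightarrow> (nat \<Rightarrow> nat) \<Rightarrow> nat \<Rightarrow> nat" where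
  "num_degree n k d = card {v \<in> {1..n}. k v = d}"

text \<open>A vertex of degree \<open>d\<close> contributes \<open>d\<close> stubs: the source of
  the factors \<open>x\<close> and \<open>y\<close> in the limit laws.\<close>

lemma card_stubs_degree:
  "card {s \<in> stubs n k. k (fst s) = d} = d * num_degree n k d"
proof -
  have "{s \<in> stubs n k. k (fst s) = d} = {v \<in> {1..n}. k v = d} \<times> {..<d}"
    by (auto simp: stubs_def)
  thus ?thesis
    by (simp add: num_degree_def card_cartesian_product)
qed

text \<open>The situation at one fixed \<open>n\<close>, with at least one stub. The latter holds
  for all large \<open>n\<close> in question, because the mean degree tends to a positive
  number.\<close>

locale block_configuration =
  fixes n :: nat and k :: "nat \<Rightarrow> nat" and b :: nat and q :: real and h :: "nat \<Rightarrow> nat"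
    and H :: "nat \<Rightarrow> nat set"
  assumes b: "b \<ge> 1"
    and q: "0 \<le> q" "q < 1"
    and h: "h permutes {1..b}" "\<And>i. i \<in> {1..b} \<Longrightarrow> h (h i) = i"
    and H_disjoint: "disjoint_family_on H {1..b}"
    and H_cover: "(\<Union>i\<in>{1..b}. H i) = UNIV"
    and even_num_stubs: "even (num_stubs n k)"
    and divisible: "b dvd num_stubs n k"
    and completable: "\<exists>i\<in>{1..b}. h i = i \<Longrightarrow> even (num_type1 n k b q)"
    and blocks: "\<And>i. i \<in> {1..b} \<Longrightarrow> block n k b i = {s \<in> stubs n k. k (fst s) \<in> H i}"
    and num_stubs_pos: "num_stubs n k > 0"
begin

abbreviation S :: "stub set" where "S \<equiv> stubs n k"
abbreviation m2 :: nat where "m2 \<equiv> num_stubs n k"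
abbreviation B :: nat where "B \<equiv> m2 div b"
abbreviation K :: nat where "K \<equiv> num_type1 n k b q"

text \<open>The block of a stub is read off the degree of its vertex, not its position in the sorted
  list. The value lies in \<open>{1..b}\<close> even for pairs that are no stubs, so 0 is free to
  mark type 2.\<close>

definition index :: "stub \<Rightarrow> nat" where
  "index s = (THE i. i \<in> {1..b} \<and> k (fst s) \<in> H i)"

lemma index_eq_iff:
  assumes "i \<in> {1..b}"
  shows "index s = i \<longleftrightarrow> k (fst s) \<in> H i"
proof -
  obtain j where j: "j \<in> {1..b}" "k (fst s) \<in> H j"
    using H_cover by blast
  have unique: "i' = j" if "i' \<in> {1..b}" "k (fst s) \<in> H i'" for i'
    using disjoint_family_onD[OF H_disjoint that(1) j(1)] that(2) j(2) by blast
  hence "index s = j"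
    unfolding index_def using j unique by (intro the_equality) blast+
  thus ?thesis
    using unique[OF assms] j(2) by blast
qed

lemma index_in: "index s \<in> {1..b}"
proof -
  obtain j where j: "j \<in> {1..b}" "k (fst s) \<in> H j"
    using H_cover by blast
  thus ?thesis
    using index_eq_iff[OF j(1)] by metis
qed

lemma index_pos [simp]: "index s \<noteq> 0"
  using index_in[of s] by simp

lemma block_eq: "i \<in> {1..b} \<Longrightarrow> block n k b i = {s \<in> S. index s = i}"
  by (simp add: blocks index_eq_iff)

lemma m2_eq: "m2 = b * B"
  using divisible by simp

lemma B_pos: "B > 0"
  using m2_eq num_stubs_pos by (metis mult_0_right gr0I)

lemma K_eq: "K = nat \<lceil>real B * q\<rceil>"
proof -
  have "real m2 = real b * real B"
    using m2_eq by (metis of_nat_mult)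
  thus ?thesis
    using b by (simp add: num_type1_def)
qed

lemma K_le: "K \<le> B"
proof -
  have "real B * q \<le> real B * 1"
    using q by (intro mult_left_mono) auto
  thus ?thesis
    unfolding K_eq by (simp add: nat_le_iff ceiling_le_iff)
qed

text \<open>\<open>permutes\<close> makes \<open>h\<close> the identity outside
  \<open>{1..b}\<close>. So \<open>h\<close> is an involution on all natural numbers and can serve
  as the map \<open>g\<close> above, with class 0 matched with itself.\<close>

lemma h_involution: "h (h a) = a"
  using h by (cases "a \<in> {1..b}") (auto simp: permutes_not_in)

lemma h_in_iff: "h a \<in> {1..b} \<longleftrightarrow> a \<in> {1..b}"
  using h(1) by (rule permutes_in_image)

lemma h_0: "h 0 = 0"
  using h(1) by (rule permutes_not_in) simp

section \<open>Outcomes of the type designation and the resulting classes\<close>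

definition admissible :: "stub set \<Rightarrow> bool" where
  "admissible T \<longleftrightarrow> T \<subseteq> S \<and> (\<forall>i\<in>{1..b}. card {s \<in> T. index s = i} = K)"

lemma finite_admissible: "finite {T. admissible T}"
  by (rule finite_subset[of _ "Pow S"]) (auto simp: admissible_def finite_stubs)

text \<open>Each block has \<open>B \<ge> K\<close> stubs, so there are sets to draw from; since the
  blocks are disjoint, the part of \<open>T\<close> in a block is exactly the set drawn
  there.\<close>

lemma type1_admissible:
  assumes "T \<in> set_pmf (type1_pmf n k b q)"
  shows "admissible T"
proof -
  have ne: "{T. T \<subseteq> block n k b i \<and> card T = K} \<noteq> {}"
    and fin: "finite {T. T \<subseteq> block n k b i \<and> card T = K}" if i: "i \<in> {1..b}" for i
  proof -
    have "K \<le> card (block n k b i)"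
      using K_le card_block[OF i divisible] by simp
    then obtain T where "T \<subseteq> block n k b i" "card T = K"
      by (rule obtain_subset_with_card_n)
    thus "{T. T \<subseteq> block n k b i \<and> card T = K} \<noteq> {}"
      by blast
    show "finite {T. T \<subseteq> block n k b i \<and> card T = K}"
      by (simp add: block_def)
  qed
  obtain D where T: "T = (\<Union>i\<in>{1..b}. D i)"
    and "D \<in> PiE_dflt {1..b} {} (set_pmf \<circ> (\<lambda>i. pmf_of_set {T. T \<subseteq> block n k b i \<and> card T = K}))"
    using assms unfolding type1_pmf_def set_map_pmf set_Pi_pmf[OF finite_atLeastAtMost] by blast
  hence *: "D i \<in> set_pmf (pmf_of_set {T. T \<subseteq> block n k b i \<and> card T = K})" if "i \<in> {1..b}" for i
    using that by (simp add: PiE_dflt_def)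
  have D: "D i \<subseteq> block n k b i \<and> card (D i) = K" if "i \<in> {1..b}" for i
    using *[OF that] unfolding set_pmf_of_set[OF ne[OF that] fin[OF that]] by blast
  have index_D: "s \<in> S \<and> index s = j" if "j \<in> {1..b}" "s \<in> D j" for s j
    using D[OF that(1)] that(2) block_eq[OF that(1)] by blast
  have D_eq: "{s \<in> T. index s = i} = D i" if i: "i \<in> {1..b}" for i
    unfolding T using i index_D by blast
  have "T \<subseteq> S"
    unfolding T using index_D by blast
  thus ?thesis
    unfolding admissible_def using D D_eq by simp
qed

definition stub_class :: "stub set \<Rightarrow> stub \<Rightarrow> nat" where
  "stub_class T s = (if s \<in> T then index s else 0)"

lemma card_admissible:
  assumes "admissible T"
  shows "card T = b * K"
proof -
  have fin: "finite T"
    using assms finite_stubs finite_subset by (auto simp: admissible_def)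
  have "T = (\<Union>i\<in>{1..b}. {s \<in> T. index s = i})"
    using index_in by blast
  also have "card \<dots> = (\<Sum>i\<in>{1..b}. card {s \<in> T. index s = i})"
    using fin by (intro card_UN_disjoint) auto
  also have "\<dots> = b * K"
    using assms by (simp add: admissible_def)
  finally show ?thesis .
qed

lemma card_stub_class:
  assumes "admissible T"
  shows "card {s \<in> S. stub_class T s = a} =
    (if a \<in> {1..b} then K else if a = 0 then m2 - b * K else 0)"
proof -
  have T: "T \<subseteq> S"
    using assms by (simp add: admissible_def)
  consider "a \<in> {1..b}" | "a = 0" | "a \<notin> {1..b}" "a \<noteq> 0"
    by blast
  thus ?thesis
  proof cases
    case 1
    hence "{s \<in> S. stub_class T s = a} = {s \<in> T. index s = a}"
      using T by (auto simp: stub_class_def)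
    thus ?thesis
      using 1 assms by (simp add: admissible_def)
  next
    case 2
    hence "{s \<in> S. stub_class T s = a} = S - T"
      using T by (auto simp: stub_class_def)
    thus ?thesis
      using 2 T finite_stubs card_admissible[OF assms]
      by (simp add: card_Diff_subset finite_subset card_stubs)
  next
    case 3
    hence eq: "{s \<in> S. stub_class T s = a} = {}"
      using index_in by (auto simp: stub_class_def)
    show ?thesis
      unfolding eq using 3 by simp
  qed
qed

lemma balanced_stub_class:
  assumes "admissible T"
  shows "balanced (stub_class T) h S"
  unfolding balanced_def card_stub_class[OF assms]
proof (intro allI conjI impI)
  fix a
  have "h a = 0 \<longleftrightarrow> a = 0"
    using h_0 h_involution by metis
  thus "(if h a \<in> {1..b} then K else if h a = 0 then m2 - b * K else 0) =
      (if a \<in> {1..b} then K else if a = 0 then m2 - b * K else 0)"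
    by (simp only: h_in_iff)
  assume a: "h a = a"
  \<comment> \<open>Class 0 is matched with itself, so \<open>m2 - b * K\<close> has to be even.
    Either \<open>h\<close> has a fixed point and \<open>K\<close> is even, or it has none and then
    \<open>b\<close> is even.\<close>
  have "even (b * K)"
  proof (cases "\<exists>i\<in>{1..b}. h i = i")
    case False
    hence "even (card {1..b})"
      using h h_in_iff by (intro even_card_fixpoint_free_involution[where h = h]) auto
    thus ?thesis
      by simp
  qed (simp add: completable)
  moreover have "even K" if "a \<in> {1..b}"
    using completable a that by blast
  ultimately show "even (if a \<in> {1..b} then K else if a = 0 then m2 - b * K else 0)"
    using even_num_stubs by simp
qed

text \<open>The block that \<open>candidates\<close> asks for is unique, namely
  \<open>index s\<close>, so a single equation between classes encodes both the types and the
  blocks.\<close>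

lemma candidates_eq:
  assumes "U \<subseteq> S" "s \<in> U"
  shows "candidates n k b h T U s = compatible (stub_class T) h U s"
proof (cases "s \<in> T")
  case True
  have "(\<exists>i\<in>{1..b}. s \<in> block n k b i \<and> t \<in> block n k b (h i)) \<longleftrightarrow> index t = h (index s)"
    if "t \<in> U" for t
  proof -
    have "s \<in> block n k b i \<and> t \<in> block n k b (h i) \<longleftrightarrow> index s = i \<and> index t = h i"
      if "i \<in> {1..b}" for i
      using that assms \<open>t \<in> U\<close> block_eq[OF that] block_eq[of "h i"] h_in_iff[of i] by auto
    thus ?thesis
      using index_in by auto
  qed
  \<comment> \<open>The class sought by a type 1 stub is never 0, so type 2 stubs are excluded by
    the equation of classes itself.\<close>
  moreover have "h (index s) \<noteq> 0"
    using h_in_iff[of "index s"] index_in[of s] by auto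
  ultimately show ?thesis
    using True by (auto simp: candidates_def compatible_def stub_class_def)
next
  case False
  thus ?thesis
    using h_0 by (auto simp: candidates_def compatible_def stub_class_def)
qed

section \<open>The two stubs of a random oriented edge\<close>

definition stub_pair :: "(stub \<times> stub) pmf" where
  "stub_pair = type1_pmf n k b q \<bind> (\<lambda>T. matched_pair (stub_class T) h (m2 div 2) S)"

lemma S_props: "finite S" "S \<noteq> {}" "card S = 2 * (m2 div 2)"
  using num_stubs_pos even_num_stubs card_stubs[of n k] by (auto simp: finite_stubs)

text \<open>For every possible \<open>T\<close> the concrete rule may be replaced by
  \<open>compatible\<close>, and for every matching the choice of an edge and then a direction by a
  uniform oriented edge. The degrees are read off last.\<close>

lemma edge_degrees_eq:
  "edge_degrees n k b q h = map_pmf (\<lambda>(s, t). (k (fst s), k (fst t))) stub_pair"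
proof -
  let ?f = "\<lambda>(s, t). (k (fst s), k (fst t))"
  have "edge_degrees n k b q h = type1_pmf n k b q \<bind> (\<lambda>T.
      connect (candidates n k b h T) (m2 div 2) S \<bind> (\<lambda>M. map_pmf ?f
        (pmf_of_set M \<bind> (\<lambda>(s, t). pmf_of_set {(s, t), (t, s)}))))"
    by (simp add: edge_degrees_def config_model_def bind_assoc_pmf map_bind_pmf
        map_pmf_def case_prod_unfold bind_return_pmf)
  also have "\<dots> = type1_pmf n k b q \<bind>
      (\<lambda>T. map_pmf ?f (matched_pair (stub_class T) h (m2 div 2) S))"
  proof (rule bind_pmf_cong[OF refl])
    fix T assume "T \<in> set_pmf (type1_pmf n k b q)"
    hence T: "admissible T"
      by (rule type1_admissible)
    have connect: "connect (candidates n k b h T) (m2 div 2) S =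
        connect (compatible (stub_class T) h) (m2 div 2) S"
      by (rule connect_cong[OF h_involution candidates_eq S_props(1) balanced_stub_class[OF T]
            S_props(3) order_refl])
    show "connect (candidates n k b h T) (m2 div 2) S \<bind> (\<lambda>M. map_pmf ?f
        (pmf_of_set M \<bind> (\<lambda>(s, t). pmf_of_set {(s, t), (t, s)}))) =
      map_pmf ?f (matched_pair (stub_class T) h (m2 div 2) S)"
      unfolding connect matched_pair_def map_bind_pmf[of ?f "connect _ _ _"]
    proof (rule bind_pmf_cong[OF refl])
      fix M assume M: "M \<in> set_pmf (connect (compatible (stub_class T) h) (m2 div 2) S)"
      note M' = connect_support_props[OF h_involution S_props(1,2) balanced_stub_class[OF T]
          S_props(3) M]
      show "map_pmf ?f (pmf_of_set M \<bind> (\<lambda>(s, t). pmf_of_set {(s, t), (t, s)})) =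
          map_pmf ?f (pmf_of_set (M \<union> M\<inverse>))"
        by (simp only: random_orientation[OF M'(1-3)])
    qed
  qed
  finally show ?thesis
    by (simp add: stub_pair_def map_bind_pmf)
qed

text \<open>The end is already uniform given \<open>T\<close>. This is why the marginal laws do not
  involve \<open>q\<close>, \<open>h\<close> or the blocks.\<close>

lemma fst_stub_pair: "map_pmf fst stub_pair = pmf_of_set S"
proof -
  have "map_pmf fst stub_pair = type1_pmf n k b q \<bind> (\<lambda>T. pmf_of_set S)"
    unfolding stub_pair_def map_bind_pmf
    by (intro bind_pmf_cong[OF refl] fst_matched_pair h_involution S_props
        balanced_stub_class type1_admissible)
  thus ?thesis
    by simp
qed

lemma snd_stub_pair: "map_pmf snd stub_pair = pmf_of_set S"
proof -
  have "map_pmf snd stub_pair = type1_pmf n k b q \<bind> (\<lambda>T. pmf_of_set S)"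
    unfolding stub_pair_def map_bind_pmf
    by (intro bind_pmf_cong[OF refl] snd_matched_pair h_involution S_props
        balanced_stub_class type1_admissible)
  thus ?thesis
    by simp
qed

lemma pmf_stub_degree:
  "pmf (map_pmf (\<lambda>s. k (fst s)) (pmf_of_set S)) d = real d * real (num_degree n k d) / real m2"
proof -
  have "S \<inter> (\<lambda>s. k (fst s)) -` {d} = {s \<in> S. k (fst s) = d}"
    by auto
  thus ?thesis
    using S_props(1,2) by (simp add: pmf_map measure_pmf_of_set card_stubs_degree card_stubs)
qed

lemma pmf_fst_edge_degrees:
  "pmf (map_pmf fst (edge_degrees n k b q h)) d = real d * real (num_degree n k d) / real m2"
proof -
  have "map_pmf fst (edge_degrees n k b q h) = map_pmf (\<lambda>s. k (fst s)) (map_pmf fst stub_pair)"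
    by (simp add: edge_degrees_eq pmf.map_comp comp_def case_prod_unfold)
  thus ?thesis
    by (simp only: fst_stub_pair pmf_stub_degree)
qed

lemma pmf_snd_edge_degrees:
  "pmf (map_pmf snd (edge_degrees n k b q h)) d = real d * real (num_degree n k d) / real m2"
proof -
  have "map_pmf snd (edge_degrees n k b q h) = map_pmf (\<lambda>s. k (fst s)) (map_pmf snd stub_pair)"
    by (simp add: edge_degrees_eq pmf.map_comp comp_def case_prod_unfold)
  thus ?thesis
    by (simp only: snd_stub_pair pmf_stub_degree)
qed

text \<open>A type 1 stub has \<open>K\<close> candidates in block \<open>h (index s)\<close>, one
  fewer if that is its own block; when \<open>h (index s) = index t\<close>, this means
  \<open>index s = index t\<close>. A type 2 stub has \<open>m2 - b * K - 1\<close> candidates.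
  Stubs of different types are never joined.\<close>

lemma pmf_matched_pair_stubs:
  assumes T: "admissible T" and s: "s \<in> S" and t: "t \<in> S" "s \<noteq> t"
  shows "pmf (matched_pair (stub_class T) h (m2 div 2) S) (s, t) =
    (of_bool (h (index s) = index t) * of_bool (s \<in> T \<and> t \<in> T) / (real K - of_bool (index s = index t))
      + of_bool (s \<notin> T \<and> t \<notin> T) / (real m2 - real b * real K - 1)) / real m2"
proof -
  have bK: "b * K \<le> m2"
    using K_le by (subst m2_eq) simp
  have pmf: "pmf (matched_pair (stub_class T) h (m2 div 2) S) (s, t) =
      (if stub_class T t = h (stub_class T s) then 1 / (real m2 *
        real (card {u \<in> S. stub_class T u = stub_class T s} - of_bool (stub_class T s = h (stub_class T s)))) else 0)"
    using s t pmf_matched_pair[OF h_involution S_props(1,2) balanced_stub_class[OF T] S_props(3)]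
      card_compatible[OF S_props(1) balanced_stub_class[OF T] s]
    by (simp add: card_stubs compatible_def)
  have card_pos: "card {u \<in> S. stub_class T u = stub_class T s} > 0"
    using s S_props(1) card_gt_0_iff[of "{u \<in> S. stub_class T u = stub_class T s}"] by fastforce
  have h_pos: "h (index s) \<noteq> 0"
    using h_in_iff[of "index s"] index_in[of s] by auto
  have in_b: "index s \<in> {1..b}"
    by (rule index_in)
  consider "s \<in> T" "t \<in> T" | "s \<notin> T" "t \<notin> T" | "s \<in> T" "t \<notin> T" | "s \<notin> T" "t \<in> T"
    by blast
  thus ?thesis
  proof cases
    case 1
    \<comment> \<open>\<open>s\<close> itself shows that its class is nonempty, so the natural
      subtraction is not truncated and agrees with the real one; likewise for type 2 below.\<close>
    have "K > 0"
      using card_pos 1 in_b unfolding card_stub_class[OF T] by (simp add: stub_class_def)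
    thus ?thesis
      using 1 in_b unfolding pmf card_stub_class[OF T]
      by (auto simp: stub_class_def of_nat_diff)
  next
    case 2
    have "m2 - b * K > 0"
      using card_pos 2 unfolding card_stub_class[OF T] by (simp add: stub_class_def)
    thus ?thesis
      using 2 bK h_0 unfolding pmf card_stub_class[OF T]
      by (simp add: stub_class_def of_nat_diff)
  next
    case 3
    thus ?thesis
      using h_pos unfolding pmf by (simp add: stub_class_def)
  next
    case 4
    thus ?thesis
      using h_0 unfolding pmf by (simp add: stub_class_def)
  qed
qed

section \<open>Hypergeometric probabilities that given stubs are all of type 2\<close>

definition avoid_ratio :: "nat \<Rightarrow> real" where
  "avoid_ratio x = real ((B - x) choose K) / real (B choose K)"

lemma binomial_pos: "real (B choose K) > 0"
  using K_le by simp

lemma avoid_ratio_0: "avoid_ratio 0 = 1"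
  using binomial_pos by (simp add: avoid_ratio_def)

lemma avoid_ratio_1: "avoid_ratio 1 = (real B - real K) / real B"
proof -
  have "real ((B - K) * (B choose K)) = real (B * ((B - 1) choose K))"
    by (simp only: binomial_absorb_comp)
  hence "(real B - real K) * real (B choose K) = real B * real ((B - 1) choose K)"
    using K_le by (simp add: of_nat_diff)
  thus ?thesis
    using binomial_pos B_pos unfolding avoid_ratio_def by (simp add: field_simps)
qed

text \<open>The absorption identity is applied once more, now to \<open>B - 1\<close>, which reduces
  the ratio for two stubs to \<open>avoid_ratio 1\<close>.\<close>

lemma avoid_ratio_2:
  assumes "B \<ge> 2"
  shows "avoid_ratio 2 = (real B - real K) * (real B - real K - 1) / (real B * (real B - 1))"
proof -
  have "real ((B - 1 - K) * ((B - 1) choose K)) = real ((B - 1) * ((B - 1 - 1) choose K))"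
    by (simp only: binomial_absorb_comp)
  moreover have "B - 1 - 1 = B - 2"
    by simp
  \<comment> \<open>For \<open>K = B\<close> the natural number \<open>B - 1 - K\<close> is 0 while
    the real difference is -1, but then the binomial coefficient is 0.\<close>
  moreover have "real (B - 1 - K) * real ((B - 1) choose K) =
      (real B - real K - 1) * real ((B - 1) choose K)"
  proof (cases "K = B")
    case False
    thus ?thesis
      using K_le assms by (simp add: of_nat_diff)
  qed (use B_pos in simp)
  ultimately have "(real B - 1) * real ((B - 2) choose K) =
      (real B - real K - 1) * real ((B - 1) choose K)"
    using assms by (simp add: of_nat_diff)
  hence "real ((B - 2) choose K) = (real B - real K - 1) / (real B - 1) * real ((B - 1) choose K)"
    using assms by (simp add: eq_divide_eq mult.commute)
  hence "avoid_ratio 2 = (real B - real K - 1) / (real B - 1) * avoid_ratio 1"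
    by (simp add: avoid_ratio_def)
  thus ?thesis
    unfolding avoid_ratio_1 by (simp add: mult.commute)
qed

text \<open>\<open>T\<close> misses \<open>X\<close> iff the draw in each block does, and these
  draws are independent. \<open>avoid_ratio x\<close> is the chance that \<open>x\<close> given
  stubs of one block all escape its draw.\<close>

lemma prob_type1_avoid:
  assumes "X \<subseteq> S"
  shows "measure_pmf.prob (type1_pmf n k b q) {T. T \<inter> X = {}} =
    (\<Prod>i\<in>{1..b}. avoid_ratio (card {s \<in> X. index s = i}))"
proof -
  have "measure_pmf.prob (type1_pmf n k b q) {T. T \<inter> X = {}} =
      measure_pmf.prob (Pi_pmf {1..b} {} (\<lambda>i. pmf_of_set {T. T \<subseteq> block n k b i \<and> card T = K}))
        (Pi {1..b} (\<lambda>_. {T. T \<inter> X = {}}))"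
    unfolding type1_pmf_def measure_map_pmf by (rule arg_cong2[where f = measure]) auto
  also have "\<dots> = (\<Prod>i\<in>{1..b}.
      measure_pmf.prob (pmf_of_set {T. T \<subseteq> block n k b i \<and> card T = K}) {T. T \<inter> X = {}})"
    by (simp add: measure_Pi_pmf_Pi)
  also have "\<dots> = (\<Prod>i\<in>{1..b}. avoid_ratio (card {s \<in> X. index s = i}))"
  proof (rule prod.cong[OF refl])
    fix i assume i: "i \<in> {1..b}"
    have "X \<inter> block n k b i = {s \<in> X. index s = i}"
      using assms block_eq[OF i] by blast
    thus "measure_pmf.prob (pmf_of_set {T. T \<subseteq> block n k b i \<and> card T = K}) {T. T \<inter> X = {}} =
        avoid_ratio (card {s \<in> X. index s = i})"
      using prob_subset_avoid[of "block n k b i" K X] K_le card_block[OF i divisible]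
      by (simp add: avoid_ratio_def block_def)
  qed
  finally show ?thesis .
qed

lemma prob_type1_avoid_1:
  assumes "s \<in> S"
  shows "measure_pmf.prob (type1_pmf n k b q) {T. s \<notin> T} = avoid_ratio 1"
proof -
  have "measure_pmf.prob (type1_pmf n k b q) {T. T \<inter> {s} = {}} =
      (\<Prod>i\<in>{1..b}. avoid_ratio (card {s' \<in> {s}. index s' = i}))"
    using assms by (intro prob_type1_avoid) simp
  also have "\<dots> = (\<Prod>i\<in>{1..b}. if i = index s then avoid_ratio 1 else 1)"
  proof (rule prod.cong[OF refl])
    fix i
    have "{s' \<in> {s}. index s' = i} = (if i = index s then {s} else {})"
      by auto
    thus "avoid_ratio (card {s' \<in> {s}. index s' = i}) = (if i = index s then avoid_ratio 1 else 1)"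
      by (simp add: avoid_ratio_0)
  qed
  also have "\<dots> = avoid_ratio 1"
    using index_in[of s] by (subst prod.delta) auto
  finally show ?thesis
    by simp
qed

text \<open>Within one block the draw is without replacement, giving \<open>avoid_ratio 2\<close>;
  in two blocks the events are independent, giving a square. All other blocks contribute
  \<open>avoid_ratio 0 = 1\<close>.\<close>

lemma prob_type1_avoid_2:
  assumes "s \<in> S" "t \<in> S" "s \<noteq> t"
  shows "measure_pmf.prob (type1_pmf n k b q) {T. s \<notin> T \<and> t \<notin> T} =
    (if index s = index t then avoid_ratio 2 else avoid_ratio 1 ^ 2)"
proof -
  have "measure_pmf.prob (type1_pmf n k b q) {T. T \<inter> {s, t} = {}} =
      (\<Prod>i\<in>{1..b}. avoid_ratio (card {s' \<in> {s, t}. index s' = i}))"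
    using assms by (intro prob_type1_avoid) simp
  also have "\<dots> = (if index s = index t then avoid_ratio 2 else avoid_ratio 1 ^ 2)"
  proof (cases "index s = index t")
    case True
    have "(\<Prod>i\<in>{1..b}. avoid_ratio (card {s' \<in> {s, t}. index s' = i})) =
        (\<Prod>i\<in>{1..b}. if i = index s then avoid_ratio 2 else 1)"
    proof (rule prod.cong[OF refl])
      fix i
      have "{s' \<in> {s, t}. index s' = i} = (if i = index s then {s, t} else {})"
        using True by auto
      thus "avoid_ratio (card {s' \<in> {s, t}. index s' = i}) = (if i = index s then avoid_ratio 2 else 1)"
        using assms(3) by (simp add: avoid_ratio_0 numeral_2_eq_2)
    qed
    also have "\<dots> = avoid_ratio 2"
      using index_in[of s] by (subst prod.delta) auto
    finally show ?thesis
      using True by simp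
  next
    case False
    have "(\<Prod>i\<in>{1..b}. avoid_ratio (card {s' \<in> {s, t}. index s' = i})) =
        (\<Prod>i\<in>{1..b}. (if i = index s then avoid_ratio 1 else 1) * (if i = index t then avoid_ratio 1 else 1))"
    proof (rule prod.cong[OF refl])
      fix i
      have "{s' \<in> {s, t}. index s' = i} =
          (if i = index s then {s} else if i = index t then {t} else {})"
        using False by auto
      thus "avoid_ratio (card {s' \<in> {s, t}. index s' = i}) =
          (if i = index s then avoid_ratio 1 else 1) * (if i = index t then avoid_ratio 1 else 1)"
        using False by (simp add: avoid_ratio_0)
    qed
    also have "\<dots> = avoid_ratio 1 ^ 2"
      using index_in[of s] index_in[of t]
      by (simp add: prod.distrib prod.delta power2_eq_square)
    finally show ?thesis
      using False by simp
  qed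
  finally show ?thesis
    by simp
qed

text \<open>
  All probabilities are expressed through those of avoiding \<open>T\<close>, using
  \<open>[s \<in> T \<and> t \<in> T] = 1 - [s \<notin> T] - [t \<notin> T] + [s \<notin> T \<and> t \<notin> T]\<close>.
\<close>

definition pair_prob :: "nat \<Rightarrow> nat \<Rightarrow> real" where
  "pair_prob i j =
    (let avoid = (if i = j then avoid_ratio 2 else avoid_ratio 1 ^ 2) in
      (of_bool (h i = j) * (1 - 2 * avoid_ratio 1 + avoid) / (real K - of_bool (i = j))
        + avoid / (real m2 - real b * real K - 1)) / real m2)"

lemma pmf_stub_pair:
  assumes s: "s \<in> S" and t: "t \<in> S" "s \<noteq> t"
  shows "pmf stub_pair (s, t) = pair_prob (index s) (index t)"
proof -
  let ?P = "type1_pmf n k b q"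
  \<comment> \<open>\<open>\<alpha>\<close> and \<open>\<beta>\<close> are the conditional
    probabilities of the oriented edge when both stubs are of type 1 and of type 2. They do not
    depend on \<open>T\<close>, so only indicators have to be averaged.\<close>
  define \<alpha> where "\<alpha> = of_bool (h (index s) = index t) / (real K - of_bool (index s = index t)) / real m2"
  define \<beta> where "\<beta> = 1 / (real m2 - real b * real K - 1) / real m2"
  have "finite (set_pmf ?P)"
    by (rule finite_subset[OF _ finite_admissible]) (use type1_admissible in blast)
  note int = integrable_measure_pmf_finite[OF this]
  have "pmf stub_pair (s, t) =
      (\<integral>T. pmf (matched_pair (stub_class T) h (m2 div 2) S) (s, t) \<partial>?P)"
    by (simp add: stub_pair_def pmf_bind)
  also have "\<dots> = (\<integral>T. \<alpha> * (1 - indicator {T. s \<notin> T} T - indicator {T. t \<notin> T} T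
      + indicator {T. s \<notin> T \<and> t \<notin> T} T) + \<beta> * indicator {T. s \<notin> T \<and> t \<notin> T} T \<partial>?P)"
  proof (rule integral_cong_AE)
    show "AE T in ?P. pmf (matched_pair (stub_class T) h (m2 div 2) S) (s, t) =
        \<alpha> * (1 - indicator {T. s \<notin> T} T - indicator {T. t \<notin> T} T
      + indicator {T. s \<notin> T \<and> t \<notin> T} T) + \<beta> * indicator {T. s \<notin> T \<and> t \<notin> T} T"
      unfolding AE_measure_pmf_iff
    proof
      fix T assume "T \<in> set_pmf ?P"
      hence T: "admissible T"
        by (rule type1_admissible)
      have "of_bool (s \<in> T \<and> t \<in> T) = (1 - indicator {T. s \<notin> T} T - indicator {T. t \<notin> T} T
          + indicator {T. s \<notin> T \<and> t \<notin> T} T :: real)"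
        by (cases "s \<in> T"; cases "t \<in> T") simp_all
      moreover have "of_bool (s \<notin> T \<and> t \<notin> T) = (indicator {T. s \<notin> T \<and> t \<notin> T} T :: real)"
        by simp
      ultimately show "pmf (matched_pair (stub_class T) h (m2 div 2) S) (s, t) =
        \<alpha> * (1 - indicator {T. s \<notin> T} T - indicator {T. t \<notin> T} T
      + indicator {T. s \<notin> T \<and> t \<notin> T} T) + \<beta> * indicator {T. s \<notin> T \<and> t \<notin> T} T"
        unfolding pmf_matched_pair_stubs[OF T s t] \<alpha>_def \<beta>_def
        by (simp only: add_divide_distrib times_divide_eq_left times_divide_eq_right mult_1_left)
    qed
  qed simp_all
  also have "\<dots> = \<alpha> * (1 - measure_pmf.prob ?P {T. s \<notin> T} - measure_pmf.prob ?P {T. t \<notin> T}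
      + measure_pmf.prob ?P {T. s \<notin> T \<and> t \<notin> T}) + \<beta> * measure_pmf.prob ?P {T. s \<notin> T \<and> t \<notin> T}"
    by (simp add: int)
  also have "\<dots> = pair_prob (index s) (index t)"
    unfolding prob_type1_avoid_1[OF s] prob_type1_avoid_1[OF t(1)] prob_type1_avoid_2[OF s t]
      \<alpha>_def \<beta>_def pair_prob_def Let_def
    by (simp add: add_divide_distrib)
  finally show ?thesis .
qed

section \<open>From pairs of stubs to pairs of degrees\<close>

lemma pmf_stub_pair_same: "pmf stub_pair (s, s) = 0"
proof -
  \<comment> \<open>A stub is never connected to itself: a self-edge of the multigraph joins two
    different stubs of one vertex.\<close>
  have "(s, s) \<notin> set_pmf stub_pair"
  proof
    assume "(s, s) \<in> set_pmf stub_pair"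
    then obtain T where T: "T \<in> set_pmf (type1_pmf n k b q)"
      and "(s, s) \<in> set_pmf (matched_pair (stub_class T) h (m2 div 2) S)"
      unfolding stub_pair_def set_bind_pmf by blast
    hence "s \<in> compatible (stub_class T) h S s"
      using matched_pair_support(2)[OF h_involution S_props(1,2)
          balanced_stub_class[OF type1_admissible[OF T]] S_props(3)] by blast
    thus False
      by (simp add: compatible_def)
  qed
  thus ?thesis
    by (simp add: set_pmf_iff)
qed

text \<open>Degrees determine blocks, so all ordered pairs of different stubs with degrees
  \<open>x\<close> and \<open>y\<close> are equally likely. The subtracted term removes the pairs
  \<open>(s, s)\<close>, which occur only for \<open>x = y\<close>.\<close>

lemma pmf_edge_degrees:
  assumes "i \<in> {1..b}" "j \<in> {1..b}" "x \<in> H i" "y \<in> H j"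
  shows "pmf (edge_degrees n k b q h) (x, y) = pair_prob i j *
    (real x * real (num_degree n k x) * (real y * real (num_degree n k y))
      - of_bool (x = y) * (real x * real (num_degree n k x)))"
proof -
  define D where "D d = {s \<in> S. k (fst s) = d}" for d
  have finite_D: "finite (D d)" for d
    by (simp add: D_def finite_stubs)
  have card_D: "real (card (D d)) = real d * real (num_degree n k d)" for d
    by (simp add: D_def card_stubs_degree)
  have "pmf (edge_degrees n k b q h) (x, y) =
      measure stub_pair ((\<lambda>(s, t). (k (fst s), k (fst t))) -` {(x, y)})"
    by (simp add: edge_degrees_eq pmf_map)
  also have "\<dots> = measure stub_pair (D x \<times> D y)"
  proof (rule measure_prob_cong_0)
    fix e assume e: "e \<in> (\<lambda>(s, t). (k (fst s), k (fst t))) -` {(x, y)} - D x \<times> D y"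
    \<comment> \<open>By the marginals both ends lie in \<open>S\<close>, so pairs with an end
      outside \<open>S\<close> carry no mass.\<close>
    have "set_pmf (map_pmf fst stub_pair) = S" "set_pmf (map_pmf snd stub_pair) = S"
      using S_props(1,2) by (simp_all add: fst_stub_pair snd_stub_pair set_pmf_of_set del: set_map_pmf)
    moreover have "fst e \<notin> S \<or> snd e \<notin> S"
      using e by (cases e) (auto simp: D_def)
    ultimately have "e \<notin> set_pmf stub_pair"
      unfolding set_map_pmf by blast
    thus "pmf stub_pair e = 0"
      by (simp add: set_pmf_iff)
  next
    fix e assume "e \<in> D x \<times> D y - (\<lambda>(s, t). (k (fst s), k (fst t))) -` {(x, y)}"
    thus "pmf stub_pair e = 0"
      by (cases e) (auto simp: D_def)
  qed
  also have "\<dots> = (\<Sum>s\<in>D x. \<Sum>t\<in>D y. pmf stub_pair (s, t))"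
    by (subst measure_measure_pmf_finite) (simp_all add: finite_D sum.cartesian_product)
  also have "\<dots> = (\<Sum>s\<in>D x. \<Sum>t\<in>D y. pair_prob i j - (if s = t then pair_prob i j else 0))"
  proof (intro sum.cong refl)
    fix s t assume "s \<in> D x" "t \<in> D y"
    hence st: "s \<in> S" "t \<in> S" and "k (fst s) = x" "k (fst t) = y"
      by (simp_all add: D_def)
    hence "index s = i" "index t = j"
      using assms by (simp_all add: index_eq_iff)
    thus "pmf stub_pair (s, t) = pair_prob i j - (if s = t then pair_prob i j else 0)"
      using pmf_stub_pair[OF st] pmf_stub_pair_same by simp
  qed
  also have "\<dots> = (\<Sum>s\<in>D x. real (card (D y)) * pair_prob i j - (if s \<in> D y then pair_prob i j else 0))"
    by (simp add: sum_subtractf sum.delta finite_D)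
  also have "\<dots> = (\<Sum>s\<in>D x. (real (card (D y)) - of_bool (x = y)) * pair_prob i j)"
  proof (intro sum.cong refl)
    fix s assume "s \<in> D x"
    hence "s \<in> D y \<longleftrightarrow> x = y"
      by (auto simp: D_def)
    thus "real (card (D y)) * pair_prob i j - (if s \<in> D y then pair_prob i j else 0) =
        (real (card (D y)) - of_bool (x = y)) * pair_prob i j"
      by (simp add: algebra_simps)
  qed
  also have "\<dots> = pair_prob i j * (real (card (D x)) * real (card (D y)) - of_bool (x = y) * real (card (D x)))"
    by (simp add: algebra_simps)
  finally show ?thesis
    by (simp only: card_D)
qed

text \<open>A form from which the limit can be read off: \<open>\<kappa>\<close> is the share of
  type 1 stubs in a block and tends to \<open>q\<close>, while \<open>\<delta>\<close> tends to 0.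
  The correction \<open>\<delta>\<close> treats \<open>i = j\<close> and \<open>i \<noteq> j\<close>
  by one formula; \<open>B \<ge> 2\<close> keeps \<open>1 - \<delta>\<close> positive.\<close>

lemma pair_prob_eq:
  fixes i j :: nat
  assumes "i \<in> {1..b}" "B \<ge> 2"
  defines "\<kappa> \<equiv> real K / real B" and "\<delta> \<equiv> of_bool (i = j) / real B"
  shows "real m2 ^ 2 * pair_prob i j =
    of_bool (h i = j) * (real b * \<kappa> / (1 - \<delta>))
    + (1 - \<kappa>) * (1 - \<kappa> - \<delta>) / (1 - \<delta>) * (real b / (real b - real b * \<kappa> - 1 / real B))"
proof -
  have B: "real B > 0" "\<delta> < 1"
    using assms(2) by (auto simp: \<delta>_def)
  have m2: "real m2 = real b * real B"
    using m2_eq by (metis of_nat_mult)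
  have K: "real K = \<kappa> * real B" "of_bool (i = j) = \<delta> * real B"
    using B by (simp_all add: \<kappa>_def \<delta>_def)
  have r1: "avoid_ratio 1 = 1 - \<kappa>"
    unfolding avoid_ratio_1 using B by (simp add: \<kappa>_def field_simps)
  define avoid where "avoid = (if i = j then avoid_ratio 2 else avoid_ratio 1 ^ 2)"
  have avoid: "avoid = (1 - \<kappa>) * (1 - \<kappa> - \<delta>) / (1 - \<delta>)"
  proof (cases "i = j")
    case True
    have "(1 - \<kappa>) * (1 - \<kappa> - \<delta>) / (1 - \<delta>) =
        ((real B - real K) / real B) * ((real B - real K - 1) / real B) / ((real B - 1) / real B)"
      using True B by (simp add: \<kappa>_def \<delta>_def diff_divide_distrib)
    also have "\<dots> = (real B - real K) * (real B - real K - 1) / (real B * (real B - 1))"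
      using B by simp
    finally show ?thesis
      using True avoid_ratio_2[OF assms(2)] by (simp add: avoid_def)
  next
    case False
    thus ?thesis
      unfolding avoid_def r1 by (simp add: \<delta>_def power2_eq_square)
  qed
  \<comment> \<open>The probability that both stubs are of type 1, by inclusion-exclusion.\<close>
  have both: "1 - 2 * avoid_ratio 1 + avoid = \<kappa> * (\<kappa> - \<delta>) / (1 - \<delta>)"
    unfolding r1 avoid using B by (simp add: field_simps)
  have "of_bool (h i = j) * (1 - 2 * avoid_ratio 1 + avoid) / (real K - of_bool (i = j)) * real m2 =
      of_bool (h i = j) * (real b * \<kappa> / (1 - \<delta>))"
  proof (cases "h i = j \<and> \<kappa> \<noteq> 0")
    case True
    \<comment> \<open>Equality would force \<open>i = j\<close>, a fixed point of \<open>h\<close>,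
      together with \<open>K = 1\<close>, against the evenness of \<open>K\<close>. So
      \<open>\<kappa> - \<delta>\<close> can be cancelled. In the other case,
      \<open>\<kappa> = 0\<close> or \<open>h i \<noteq> j\<close>, both sides of the goal are
      0.\<close>
    have "\<kappa> \<noteq> \<delta>"
    proof
      assume eq: "\<kappa> = \<delta>"
      hence "i = j"
        using True by (auto simp: \<delta>_def)
      hence "even K"
        using completable True assms(1) by blast
      moreover have "real K = 1"
        using eq K \<open>i = j\<close> by simp
      ultimately show False
        by simp
    qed
    hence "\<kappa> * (\<kappa> - \<delta>) / (1 - \<delta>) / (\<kappa> * real B - \<delta> * real B) * (real b * real B) = real b * \<kappa> / (1 - \<delta>)"
      using B by (simp flip: left_diff_distrib)
    thus ?thesis
      unfolding both K m2 using True by simp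
  next
    case False
    thus ?thesis
      unfolding both by auto
  qed
  moreover have "real m2 / (real m2 - real b * real K - 1) = real b / (real b - real b * \<kappa> - 1 / real B)"
  proof -
    have "real b / (real b - real b * \<kappa> - 1 / real B) =
        real b * real B / ((real b - real b * \<kappa> - 1 / real B) * real B)"
      using B by simp
    also have "(real b - real b * \<kappa> - 1 / real B) * real B = real m2 - real b * real K - 1"
      using B by (simp add: m2 K(1) algebra_simps)
    finally show ?thesis
      by (simp add: m2)
  qed
  moreover have "real m2 ^ 2 * pair_prob i j =
      of_bool (h i = j) * (1 - 2 * avoid_ratio 1 + avoid) / (real K - of_bool (i = j)) * real m2
      + avoid * (real m2 / (real m2 - real b * real K - 1))"
  proof -
    have "M ^ 2 * ((u + a / v) / M) = u * M + a * (M / v)" if "M \<noteq> 0" for M u a v :: real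
      using that by (simp add: power2_eq_square algebra_simps add_divide_distrib)
    from this[of "real m2"] show ?thesis
      using num_stubs_pos by (simp only: pair_prob_def Let_def avoid_def of_nat_eq_0_iff)
  qed
  ultimately show ?thesis
    by (simp only: avoid)
qed

end

section \<open>The limit\<close>

text \<open>Rounding up changes \<open>B n * q\<close> by at most 1, which vanishes after division
  by \<open>B n\<close>.\<close>

lemma tendsto_nat_ceiling_div:
  fixes B :: "'a \<Rightarrow> real"
  assumes "filterlim B at_top F" "q \<ge> 0"
  shows "((\<lambda>n. real (nat \<lceil>B n * q\<rceil>) / B n) \<longlongrightarrow> q) F"
proof (rule tendsto_sandwich)
  have pos: "\<forall>\<^sub>F n in F. B n > 0"
    using assms(1) by (simp add: filterlim_at_top_dense)
  have bounds: "B n * q \<le> real (nat \<lceil>B n * q\<rceil>) \<and> real (nat \<lceil>B n * q\<rceil>) \<le> B n * q + 1"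
    if "B n > 0" for n
  proof -
    have "B n * q \<ge> 0"
      using that assms(2) by simp
    hence "real (nat \<lceil>B n * q\<rceil>) = of_int \<lceil>B n * q\<rceil>"
      by simp
    thus ?thesis
      using ceiling_correct[of "B n * q"] by linarith
  qed
  show "\<forall>\<^sub>F n in F. q \<le> real (nat \<lceil>B n * q\<rceil>) / B n"
    using pos
  proof eventually_elim
    case (elim n)
    thus ?case
      using bounds[of n] by (simp add: field_simps)
  qed
  show "\<forall>\<^sub>F n in F. real (nat \<lceil>B n * q\<rceil>) / B n \<le> q + 1 / B n"
    using pos
  proof eventually_elim
    case (elim n)
    thus ?case
      using bounds[of n] by (simp add: field_simps)
  qed
  have "((\<lambda>n. q + 1 / B n) \<longlongrightarrow> q + 0) F"
    by (intro tendsto_intros tendsto_divide_0[OF tendsto_const] filterlim_at_top_imp_at_infinity assms)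
  thus "((\<lambda>n. q + 1 / B n) \<longlongrightarrow> q) F"
    by simp
qed simp

theorem theorem1:
  fixes b :: nat and q :: real and h :: "nat \<Rightarrow> nat"
    and p :: "nat pmf" and EZ :: real and H :: "nat \<Rightarrow> nat set"
    and N :: "nat set" and k :: "nat \<Rightarrow> nat \<Rightarrow> nat"
  assumes b: "b \<ge> 1"
    and q: "0 \<le> q" "q < 1"
    and h: "h permutes {1..b}" "\<And>i. i \<in> {1..b} \<Longrightarrow> h (h i) = i"
    and EZ: "((\<lambda>d. real d * pmf p d) has_sum EZ) UNIV" "0 < EZ"
    and H_disjoint: "disjoint_family_on H {1..b}"
    and H_cover: "(\<Union>i\<in>{1..b}. H i) = UNIV"
    and H_sum: "\<And>i. i \<in> {1..b} \<Longrightarrow> ((\<lambda>d. real d * pmf p d) has_sum (EZ / real b)) (H i)"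
    and N: "infinite N" "\<And>n. n \<in> N \<Longrightarrow> 0 < n"
    and even: "\<And>n. n \<in> N \<Longrightarrow> even (num_stubs n (k n))"
    and divisible: "\<And>n. n \<in> N \<Longrightarrow> b dvd num_stubs n (k n)"
    and completable:
      "\<And>n. n \<in> N \<Longrightarrow> \<exists>i\<in>{1..b}. h i = i \<Longrightarrow> even (num_type1 n (k n) b q)"
    and blocks: "\<And>n i. n \<in> N \<Longrightarrow> i \<in> {1..b} \<Longrightarrow>
      block n (k n) b i = {s \<in> stubs n (k n). k n (fst s) \<in> H i}"
    and degree_distribution: "\<And>d.
      ((\<lambda>n. real (card {v \<in> {1..n}. k n v = d}) / real n) \<longlongrightarrow> pmf p d) (inf at_top (principal N))"
    and mean_degree:
      "((\<lambda>n. real (num_stubs n (k n)) / real n) \<longlongrightarrow> EZ) (inf at_top (principal N))"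
  shows "(\<forall>x. ((\<lambda>n. pmf (map_pmf fst (edge_degrees n (k n) b q h)) x)
                \<longlongrightarrow> real x * pmf p x / EZ) (inf at_top (principal N)))
       \<and> (\<forall>y. ((\<lambda>n. pmf (map_pmf snd (edge_degrees n (k n) b q h)) y)
                \<longlongrightarrow> real y * pmf p y / EZ) (inf at_top (principal N)))
       \<and> (\<forall>i\<in>{1..b}. \<forall>j\<in>{1..b}. \<forall>x\<in>H i. \<forall>y\<in>H j.
            ((\<lambda>n. pmf (edge_degrees n (k n) b q h) (x, y))
                \<longlongrightarrow> (if h i = j then real b * q + 1 - q else 1 - q)
                    * (real x * real y * pmf p x * pmf p y / EZ\<^sup>2)) (inf at_top (principal N)))"
proof -
  \<comment> \<open>The limit of \<open>n\<close> to infinity within \<open>N\<close>.\<close>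
  define F where "F = inf at_top (principal N)"
  define M where "M n = real (num_stubs n (k n))" for n
  \<comment> \<open>The probability that a uniformly random stub belongs to a vertex of degree
    \<open>d\<close>.\<close>
  define P where "P d n = real d * real (num_degree n (k n) d) / M n" for d n
  define B where "B n = M n / real b" for n
  define \<kappa> where "\<kappa> n = real (nat \<lceil>B n * q\<rceil>) / B n" for n
  have in_N: "\<forall>\<^sub>F n in F. n \<in> N"
    by (simp add: F_def eventually_inf_principal)
  have n_top: "filterlim real at_top F"
    by (rule filterlim_mono[OF filterlim_real_sequentially order_refl]) (simp add: F_def)
  have mean: "((\<lambda>n. M n / real n) \<longlongrightarrow> EZ) F"
    using mean_degree by (simp add: M_def F_def)
  \<comment> \<open>As the mean degree tends to \<open>EZ > 0\<close>, the number of stubs and with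
    it the block size tend to infinity, so every lower bound needed on them holds
    eventually.\<close>
  have "filterlim (\<lambda>n. M n / real n * real n) at_top F"
    using mean EZ(2) n_top by (rule filterlim_tendsto_pos_mult_at_top)
  moreover have "\<forall>\<^sub>F n in F. M n / real n * real n = M n"
    using in_N by eventually_elim (simp add: N(2))
  ultimately have M_top: "filterlim M at_top F"
    by (rule filterlim_cong[OF refl refl, THEN iffD1, rotated])
  have "filterlim (\<lambda>n. inverse (real b) * M n) at_top F"
    using b by (intro filterlim_tendsto_pos_mult_at_top[OF tendsto_const _ M_top]) simp
  hence B_top: "filterlim B at_top F"
    by (simp add: B_def[abs_def] field_simps)
  have config: "\<forall>\<^sub>F n in F. block_configuration n (k n) b q h H"
    using in_N filterlim_at_top_dense[THEN iffD1, OF M_top, rule_format, of 0]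
  proof eventually_elim
    case (elim n)
    thus ?case
      using assms by unfold_locales (auto simp: M_def)
  qed
  have P_lim: "((\<lambda>n. P d n) \<longlongrightarrow> real d * pmf p d / EZ) F" for d
  proof -
    \<comment> \<open>Numerator and denominator are divided by \<open>n\<close>, so that the two
      convergence hypotheses apply.\<close>
    have "((\<lambda>n. real d * (real (num_degree n (k n) d) / real n) / (M n / real n))
        \<longlongrightarrow> real d * pmf p d / EZ) F"
      using degree_distribution[of d] EZ(2)
      by (intro tendsto_intros mean) (simp_all add: num_degree_def F_def)
    moreover have "\<forall>\<^sub>F n in F.
        real d * (real (num_degree n (k n) d) / real n) / (M n / real n) = P d n"
      using in_N by eventually_elim (simp add: N(2) P_def)
    ultimately show ?thesis
      by (rule Lim_transform_eventually)
  qed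
  have fst_lim: "((\<lambda>n. pmf (map_pmf fst (edge_degrees n (k n) b q h)) x)
      \<longlongrightarrow> real x * pmf p x / EZ) F" for x
  proof (rule Lim_transform_eventually[OF P_lim])
    show "\<forall>\<^sub>F n in F. P x n = pmf (map_pmf fst (edge_degrees n (k n) b q h)) x"
      using config
      by eventually_elim (simp only: block_configuration.pmf_fst_edge_degrees P_def M_def)
  qed
  have snd_lim: "((\<lambda>n. pmf (map_pmf snd (edge_degrees n (k n) b q h)) y)
      \<longlongrightarrow> real y * pmf p y / EZ) F" for y
  proof (rule Lim_transform_eventually[OF P_lim])
    show "\<forall>\<^sub>F n in F. P y n = pmf (map_pmf snd (edge_degrees n (k n) b q h)) y"
      using config
      by eventually_elim (simp only: block_configuration.pmf_snd_edge_degrees P_def M_def)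
  qed
  have joint_lim: "((\<lambda>n. pmf (edge_degrees n (k n) b q h) (x, y)) \<longlongrightarrow>
      (if h i = j then real b * q + 1 - q else 1 - q) *
        (real x * real y * pmf p x * pmf p y / EZ\<^sup>2)) F"
    if ij: "i \<in> {1..b}" "j \<in> {1..b}" and xy: "x \<in> H i" "y \<in> H j" for i j x y
  proof -
    define \<delta> where "\<delta> n = of_bool (i = j) / B n" for n
    \<comment> \<open>The right-hand side of \<open>pair_prob_eq\<close>, with type 1 edges in the
      first summand and type 2 edges in the second.\<close>
    define W where "W n = of_bool (h i = j) * (real b * \<kappa> n / (1 - \<delta> n))
      + (1 - \<kappa> n) * (1 - \<kappa> n - \<delta> n) / (1 - \<delta> n) * (real b / (real b - real b * \<kappa> n - 1 / B n))" for n
    note inv_lim = tendsto_divide_0[OF tendsto_const filterlim_at_top_imp_at_infinity]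
    have \<kappa>_lim: "(\<kappa> \<longlongrightarrow> q) F"
      unfolding \<kappa>_def by (rule tendsto_nat_ceiling_div[OF B_top q(1)])
    have \<delta>_lim: "(\<delta> \<longlongrightarrow> 0) F"
      unfolding \<delta>_def by (rule inv_lim[OF B_top])
    \<comment> \<open>\<open>q < 1\<close> leaves a positive share of type 2 stubs, so the
      denominator of the second summand does not tend to 0.\<close>
    have nz: "real b - real b * q - 0 \<noteq> 0"
      using b q by simp
    have "(W \<longlongrightarrow> of_bool (h i = j) * (real b * q / (1 - 0))
        + (1 - q) * (1 - q - 0) / (1 - 0) * (real b / (real b - real b * q - 0))) F"
      unfolding W_def using nz by (intro tendsto_intros \<kappa>_lim \<delta>_lim inv_lim[OF B_top]) simp_all
    \<comment> \<open>Both stubs are of type 2 with limiting probability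
      \<open>(1 - q) * (1 - q)\<close>; one factor cancels against the share of stubs among which a
      type 2 stub chooses.\<close>
    moreover have "real b - real b * q - 0 = real b * (1 - q)"
      by (simp add: algebra_simps)
    hence "(1 - q) * (1 - q - 0) / (1 - 0) * (real b / (real b - real b * q - 0)) = 1 - q"
      using b q by simp
    ultimately have "(W \<longlongrightarrow> of_bool (h i = j) * (real b * q / (1 - 0)) + (1 - q)) F"
      by (simp only:)
    hence W_lim: "(W \<longlongrightarrow> (if h i = j then real b * q + 1 - q else 1 - q)) F"
      by (cases "h i = j") (simp_all add: algebra_simps)
    \<comment> \<open>The excluded pairs \<open>(s, s)\<close> contribute a term of order
      \<open>1 / M n\<close>, which disappears in the limit.\<close>
    have "((\<lambda>n. P x n * P y n - P x n * (of_bool (x = y) / M n)) \<longlongrightarrow>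
        (real x * pmf p x / EZ) * (real y * pmf p y / EZ) - (real x * pmf p x / EZ) * 0) F"
      by (intro tendsto_intros P_lim inv_lim[OF M_top])
    hence "((\<lambda>n. W n * (P x n * P y n - P x n * (of_bool (x = y) / M n))) \<longlongrightarrow>
        (if h i = j then real b * q + 1 - q else 1 - q) *
        ((real x * pmf p x / EZ) * (real y * pmf p y / EZ) - (real x * pmf p x / EZ) * 0)) F"
      by (intro tendsto_mult W_lim)
    hence lim: "((\<lambda>n. W n * (P x n * P y n - P x n * (of_bool (x = y) / M n))) \<longlongrightarrow>
        (if h i = j then real b * q + 1 - q else 1 - q) *
        (real x * real y * pmf p x * pmf p y / EZ\<^sup>2)) F"
      by (simp add: power2_eq_square mult_ac)
    \<comment> \<open>Once \<open>B n \<ge> 2\<close>, the exact formula applies; the factor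
      \<open>M n ^ 2\<close> in \<open>W n\<close> is what turns the two counts of stubs into
      \<open>P x n\<close> and \<open>P y n\<close>.\<close>
    have "\<forall>\<^sub>F n in F. W n * (P x n * P y n - P x n * (of_bool (x = y) / M n)) =
        pmf (edge_degrees n (k n) b q h) (x, y)"
      using config filterlim_at_top[THEN iffD1, OF B_top, rule_format, of 2]
    proof eventually_elim
      case (elim n)
      interpret block_configuration n "k n" b q h H
        by fact
      have B_eq: "B n = real (num_stubs n (k n) div b)"
        using divisible b by (simp add: B_def M_def real_of_nat_div)
      have "num_stubs n (k n) div b \<ge> 2"
        using elim(2) by (simp add: B_eq)
      note W = pair_prob_eq[OF ij(1) this, of j]
      have "W n = M n ^ 2 * pair_prob i j"
        unfolding W_def \<delta>_def \<kappa>_def M_def B_eq W K_eq by simp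
      moreover have "M n > 0"
        using num_stubs_pos by (simp add: M_def)
      ultimately show ?case
        unfolding pmf_edge_degrees[OF ij xy] P_def
        by (simp add: field_simps power2_eq_square)
    qed
    with lim show ?thesis
      by (rule Lim_transform_eventually)
  qed
  show ?thesis
    using fst_lim snd_lim joint_lim unfolding F_def by blast
qed

end
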